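(* Let $c\in(0,\tfrac12)$ be a constant. There exist sufficiently large constants $C,C_0,C_1,K>0$ depending only on $c$ such that the following holds. Let $n\ge16$, $\lambda\in[c,\tfrac12)$, $\pi^*\in\mathfrak S_n$, $N\ge Cn\log n$, and $T=\lfloor\log\log n\rfloor$. Consider the noisy sorting model with underlying permutation $\pi^*$ and probability matrix $M=M_n^*(\lambda)$ under sampling with replacement. Then, with probability at least $1-n^{-7}$, the Multistage Sorting (MS) algorithm with $T$ stages (with constants $C_0,C_1$ in its definition) outputs a permutation $\hat\pi^{\mathsf{MS}}$ satisfying $$\|\hat\pi^{\mathsf{MS}}-\pi^*\|_\infty\le K\,\frac{n^2}{N}(\log n)\log\log n$$ and $$d_{\mathsf{KT}}(\hat\pi^{\mathsf{MS}},\pi^* )\le K\,\frac{n^3}{N}(\log n)\log\log n .$$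
   Context: $\mathfrak S_n$ is the set of permutations of $[n]=\{1,\dots,n\}$, $d_{\mathsf{KT}}(\pi,\sigma)=\sum_{(i,j):\sigma(i)<\sigma(j)}\mathbf 1(\pi(i)>\pi(j))$, and $\|\pi-\sigma\|_\infty=\max_{i\in[n]}|\pi(i)-\sigma(i)|$. $M_n^*(\lambda)$ is the $n\times n$ matrix with entries $\tfrac12+\lambda$ for $i>j$, $\tfrac12-\lambda$ for $i<j$, and $\tfrac12$ for $i=j$. Noisy sorting with replacement: each comparison is made on a pair of distinct items chosen uniformly from the $\binom n2$ pairs, independently across comparisons, and when $i$ and $j$ are compared, $i$ beats $j$ with probability $M_{\pi^*(i),\pi^*(j)}$, independently. Observations and splitting: $2N$ comparisons are observed in total and split into two independent samples of size $N$. The first is split into two subsamples of size $N/2$; $A'_{i,j}$, $A''_{i,j}$ denote the numbers of wins of $i$ against $j$ in these. The second is split into $T$ subsamples of size $N/T$; $A^{(t)}_{i,j}$ is the number of wins of $i$ against $j$ in the $t$-th one, $t\in[T]$. ($N$ is assumed even and divisible by $T$.) Estimator $\hat\lambda$: let $S_i=\sum_{j=1}^nA'_{i,j}$; let $\tilde\pi\in\mathfrak S_n$ sort the scores $S_i$ in increasing order ($\tilde\pi(i)<\tilde\pi(j)$ whenever $S_i<S_j$, ties broken arbitrarily); put $$\hat\lambda=\frac2N\binom n2\binom{n/2}{2}^{-1}\sum_{(i,j):\,\tilde\pi(i)-\tilde\pi(j)>n/2}A''_{i,j}-\frac12,\qquad \binom{n/2}{2}=\tfrac12\cdot\tfrac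 n2\big(\tfrac n2-1\big).$$ MS algorithm: 1. For each $i\in[n]$ set $I^{(0)}(i)=[n]$, $I^{(0)}_-(i)=I^{(0)}_+(i)=\varnothing$. 2. At stage $t=1,\dots,T$, compute for each $i$ $$S^{(t)}_i=\frac{Tn(n-1)}{2N}\sum_{j\in I^{(t-1)}(i)}A^{(t)}_{i,j}+\sum_{j\in I_-^{(t-1)}(i)}\big(\tfrac12+\hat\lambda\big)+\sum_{j\in I_+^{(t-1)}(i)}\big(\tfrac12-\hat\lambda\big).$$ 3. For each $i$: if $|I^{(t-1)}(i)|\ge C_1n^2\frac TN\log(nT)$, set $\tau^{(t)}_i=(10+2C_0)\,n\sqrt{|I^{(t-1)}(i)|\,T N^{-1}\log(nT)}$ and define $I^{(t)}_-(i)=\{j:S^{(t)}_j-S^{(t)}_i<-\tau^{(t)}_i\}$, $I^{(t)}_+(i)=\{j:S^{(t)}_j-S^{(t)}_i>\tau_i^{(t)}\}$, $I^{(t)}(i)=[n]\setminus(I^{(t)}_-(i)\cup I^{(t)}_+(i))$. Otherwise keep $I^{(t)}(i)=I^{(t-1)}(i)$, $I_\pm^{(t)}(i)=I_\pm^{(t-1)}(i)$. 4. After stage $T$, output $\hat\pi^{\mathsf{MS}}$ sorting the scores $S^{(T)}_i$ in increasing order ($\hat\pi^{\mathsf{MS}}(i)<\hat\pi^{\mathsf{MS}}(j)$ whenever $S^{(T)}_i<S^{(T)}_j$, ties broken arbitrarily). *)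

theory Defs
  imports "HOL-Probability.Probability" "HOL-Combinatorics.Permutations"
begin

text \<open>
  Items are the elements of \<open>{1..n}\<close>, and a permutation of \<open>{1..n}\<close> is a function
  \<open>\<pi>\<close> with \<open>\<pi> permutes {1..n}\<close>. All logarithms are binary. The base only
  matters in the number of stages \<open>T = \<lfloor>log log n\<rfloor>\<close>: everywhere else a change of base is
  absorbed by the constants, but the procedure needs \<open>2 ^ T\<close> of order \<open>log n\<close>.
\<close>

definition kt_dist :: "nat \<Rightarrow> (nat \<Rightarrow> nat) \<Rightarrow> (nat \<Rightarrow> nat) \<Rightarrow> real" where
  "kt_dist n \<pi> \<sigma> =
     (\<Sum>(i, j) \<in> {(i, j) \<in> {1..n} \<times> {1..n}. \<sigma> i < \<sigma> j}. of_bool (\<pi> i > \<pi> j))"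

definition linf_dist :: "nat \<Rightarrow> (nat \<Rightarrow> nat) \<Rightarrow> (nat \<Rightarrow> nat) \<Rightarrow> real" where
  "linf_dist n \<pi> \<sigma> = Max ((\<lambda>i. \<bar>real (\<pi> i) - real (\<sigma> i)\<bar>) ` {1..n})"

definition noisy_matrix :: "real \<Rightarrow> nat \<Rightarrow> nat \<Rightarrow> real" where
  "noisy_matrix lam i j =
     (if i > j then 1/2 + lam else if i < j then 1/2 - lam else 1/2)"

text \<open>
  The outcome of one comparison is recorded as the ordered pair (winner, loser). The unordered
  pair of compared items is represented by its increasing enumeration.
\<close>

definition comparison_pmf :: "nat \<Rightarrow> real \<Rightarrow> (nat \<Rightarrow> nat) \<Rightarrow> (nat \<times> nat) pmf" where
  "comparison_pmf n lam \<pi> =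
     bind_pmf (pmf_of_set {(i, j) \<in> {1..n} \<times> {1..n}. i < j})
       (\<lambda>(i, j). map_pmf (\<lambda>b. if b then (i, j) else (j, i))
                   (bernoulli_pmf (noisy_matrix lam (\<pi> i) (\<pi> j))))"

definition comparisons_pmf ::
    "nat \<Rightarrow> real \<Rightarrow> (nat \<Rightarrow> nat) \<Rightarrow> nat \<Rightarrow> (nat \<Rightarrow> nat \<times> nat) pmf" where
  "comparisons_pmf n lam \<pi> m = Pi_pmf {..<m} undefined (\<lambda>_. comparison_pmf n lam \<pi>)"

text \<open>
  \<open>wins \<omega> B i j\<close> is the number of wins of \<open>i\<close> against \<open>j\<close> in the
  subsample consisting of the comparisons with index in \<open>B\<close>. The \<open>2 * N\<close> comparisons
  are split into consecutive blocks.
\<close>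

definition wins :: "(nat \<Rightarrow> nat \<times> nat) \<Rightarrow> nat set \<Rightarrow> nat \<Rightarrow> nat \<Rightarrow> nat" where
  "wins \<omega> B i j = card {k \<in> B. \<omega> k = (i, j)}"

definition wins1 :: "nat \<Rightarrow> (nat \<Rightarrow> nat \<times> nat) \<Rightarrow> nat \<Rightarrow> nat \<Rightarrow> nat" where
  "wins1 N \<omega> = wins \<omega> {0..<N div 2}"

definition wins2 :: "nat \<Rightarrow> (nat \<Rightarrow> nat \<times> nat) \<Rightarrow> nat \<Rightarrow> nat \<Rightarrow> nat" where
  "wins2 N \<omega> = wins \<omega> {N div 2..<N}"

definition stage_wins ::
    "nat \<Rightarrow> nat \<Rightarrow> (nat \<Rightarrow> nat \<times> nat) \<Rightarrow> nat \<Rightarrow> nat \<Rightarrow> nat \<Rightarrow> nat" where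
  "stage_wins N T \<omega> t = wins \<omega> {N + (t - 1) * (N div T)..<N + t * (N div T)}"

text \<open>
  A way of sorting scores in increasing order, including an arbitrary rule for breaking ties.
\<close>

definition sorting_rule :: "nat \<Rightarrow> ((nat \<Rightarrow> real) \<Rightarrow> nat \<Rightarrow> nat) \<Rightarrow> bool" where
  "sorting_rule n srt \<longleftrightarrow>
     (\<forall>S. srt S permutes {1..n} \<and>
          (\<forall>i\<in>{1..n}. \<forall>j\<in>{1..n}. S i < S j \<longrightarrow> srt S i < srt S j))"

text \<open>The conditions and formulas involving \<open>n/2\<close> are read in the reals, also for odd \<open>n\<close>.\<close>

definition lam_hat ::
    "nat \<Rightarrow> nat \<Rightarrow> ((nat \<Rightarrow> real) \<Rightarrow> nat \<Rightarrow> nat) \<Rightarrow> (nat \<Rightarrow> nat \<times> nat) \<Rightarrow> real" where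
  "lam_hat n N srt \<omega> =
     (let S = (\<lambda>i. \<Sum>j\<in>{1..n}. real (wins1 N \<omega> i j));
          \<pi>' = srt S
      in 2 / real N * real (n choose 2) * inverse (1/2 * (real n / 2) * (real n / 2 - 1)) *
         (\<Sum>(i, j) \<in> {(i, j) \<in> {1..n} \<times> {1..n}. real (\<pi>' i) - real (\<pi>' j) > real n / 2}.
            real (wins2 N \<omega> i j)) - 1/2)"

text \<open>
  The state after a stage assigns to each item \<open>i\<close> the triple
  \<open>(I(i), I\<^sub>-(i), I\<^sub>+(i))\<close>. The argument \<open>A\<close> is the win count matrix of the
  current stage and \<open>lh\<close> the estimate of the noise parameter.
\<close>

type_synonym ms_state = "nat \<Rightarrow> nat set \<times> nat set \<times> nat set"

definition ms_score ::
    "nat \<Rightarrow> nat \<Rightarrow> nat \<Rightarrow> real \<Rightarrow> (nat \<Rightarrow> nat \<Rightarrow> nat) \<Rightarrow> ms_state \<Rightarrow> nat \<Rightarrow> real" where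
  "ms_score n N T lh A P i =
     (case P i of (I, L, U) \<Rightarrow>
        real T * real n * (real n - 1) / (2 * real N) * (\<Sum>j\<in>I. real (A i j))
        + (\<Sum>j\<in>L. 1/2 + lh) + (\<Sum>j\<in>U. 1/2 - lh))"

definition ms_update ::
    "real \<Rightarrow> real \<Rightarrow> nat \<Rightarrow> nat \<Rightarrow> nat \<Rightarrow> real \<Rightarrow> (nat \<Rightarrow> nat \<Rightarrow> nat) \<Rightarrow> ms_state \<Rightarrow> ms_state" where
  "ms_update C0 C1 n N T lh A P = (\<lambda>i.
     (case P i of (I, L, U) \<Rightarrow>
        if real (card I) \<ge> C1 * (real n)\<^sup>2 * (real T / real N) * log 2 (real n * real T) then
          (let S = ms_score n N T lh A P;
               \<tau> = (10 + 2 * C0) * real n *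
                    sqrt (real (card I) * real T / real N * log 2 (real n * real T));
               L' = {j \<in> {1..n}. S j - S i < - \<tau>};
               U' = {j \<in> {1..n}. S j - S i > \<tau>}
           in ({1..n} - (L' \<union> U'), L', U'))
        else (I, L, U)))"

text \<open>Below, \<open>A t\<close> is the win count matrix of stage \<open>t\<close>.\<close>

primrec ms_sets ::
    "real \<Rightarrow> real \<Rightarrow> nat \<Rightarrow> nat \<Rightarrow> nat \<Rightarrow> real \<Rightarrow> (nat \<Rightarrow> nat \<Rightarrow> nat \<Rightarrow> nat) \<Rightarrow> nat \<Rightarrow> ms_state" where
  "ms_sets C0 C1 n N T lh A 0 = (\<lambda>i. ({1..n}, {}, {}))"
| "ms_sets C0 C1 n N T lh A (Suc t) =
     ms_update C0 C1 n N T lh (A (Suc t)) (ms_sets C0 C1 n N T lh A t)"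

text \<open>
  The final scores are those of stage \<open>T\<close>, hence computed from the sets after stage
  \<open>T - 1\<close>. The rules \<open>srt1\<close> and \<open>srt2\<close> sort the preliminary and the final scores.
\<close>

definition ms_perm ::
    "real \<Rightarrow> real \<Rightarrow> nat \<Rightarrow> nat \<Rightarrow> nat \<Rightarrow> ((nat \<Rightarrow> real) \<Rightarrow> nat \<Rightarrow> nat) \<Rightarrow>
     ((nat \<Rightarrow> real) \<Rightarrow> nat \<Rightarrow> nat) \<Rightarrow> (nat \<Rightarrow> nat \<times> nat) \<Rightarrow> nat \<Rightarrow> nat" where
  "ms_perm C0 C1 n N T srt1 srt2 \<omega> =
     (let lh = lam_hat n N srt1 \<omega>;
          A = stage_wins N T \<omega>
      in srt2 (ms_score n N T lh (A T) (ms_sets C0 C1 n N T lh A (T - 1))))"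

end

theory Submission
  imports Defs
begin

text \<open>
  Put \<open>\<beta> = n\<^sup>2 (T / N) log (n T)\<close>. Given the earlier stages, the score of an item in the current
  stage is, up to an error of order \<open>sqrt (|I(i)| \<beta>)\<close>, an affine function of its rank: the sampling
  noise is controlled by a Chernoff bound, and replacing \<open>\<lambda>\<close> by its estimate changes the slope and
  costs at most \<open>|I(i)| - 1\<close> times the error of the estimate. Hence each updated \<open>I(i)\<close> lies between
  two windows of ranks around the rank of \<open>i\<close> whose radii are of order \<open>sqrt (|I(i)| \<beta>)\<close>. The
  sizes therefore stay comparable among the items that are still being refined, and they satisfy
  \<open>r' \<le> const * sqrt (r \<beta>)\<close>. Since \<open>2 ^ T\<close> is of order \<open>log n\<close>, the sizes have dropped from \<open>n\<close>
  to \<open>O(1 + \<beta>)\<close> before the last stage, whose scores then sort all pairs of items at rank distance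
  \<open>O(\<beta>)\<close> or more correctly.

  For odd \<open>n\<close> the estimate of \<open>\<lambda>\<close> has a bias of order \<open>1 / n\<close>, which does not vanish as
  \<open>N\<close> grows. It only matters for items with \<open>|I(i)| \<ge> 2\<close> after the first stage. Such items
  exist only if \<open>n \<beta>\<close> is bounded below, and then the noise dominates the bias as soon as \<open>n\<close>
  exceeds a constant; for smaller \<open>n\<close> the choice of \<open>C\<close> rules them out.
\<close>

section \<open>Sorting by approximate scores\<close>

lemma card_rank_eq:
  assumes "\<pi> permutes {1..n}"
  shows "card {j \<in> {1..n}. Q (\<pi> j)} = card {r \<in> {1..n}. Q r}"
proof -
  have "{r \<in> {1..n}. Q r} = \<pi> ` {j \<in> {1..n}. Q (\<pi> j)}"
  proof -
    have "{r \<in> \<pi> ` {1..n}. Q r} = \<pi> ` {j \<in> {1..n}. Q (\<pi> j)}" by blast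
    then show ?thesis unfolding permutes_image[OF assms] .
  qed
  moreover have "inj_on \<pi> {j \<in> {1..n}. Q (\<pi> j)}"
    using permutes_inj_on[OF assms] .
  ultimately show ?thesis by (simp add: card_image)
qed

lemma permutes_range:
  assumes "\<pi> permutes {1..n}" "i \<in> {1..n}"
  shows "1 \<le> \<pi> i" "\<pi> i \<le> n"
  using permutes_in_image[OF assms(1), of i] assms(2) by auto

lemma approx_sorted_dist:
  assumes p: "\<pi> permutes {1..n}" and s: "\<sigma> permutes {1..n}" and D: "0 \<le> D"
    and ord: "\<And>i j. i \<in> {1..n} \<Longrightarrow> j \<in> {1..n} \<Longrightarrow> real (\<pi> i) - real (\<pi> j) > D \<Longrightarrow> \<sigma> j < \<sigma> i"
    and i: "i \<in> {1..n}"
  shows "\<bar>real (\<sigma> i) - real (\<pi> i)\<bar> \<le> D"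
proof -
  define k where "k = nat \<lfloor>D\<rfloor>"
  have k: "real k \<le> D" "D < real k + 1" using D unfolding k_def by linarith+
  note r = permutes_range[OF p i] permutes_range[OF s i]
  have "{1..\<pi> i - 1 - k} \<subseteq> {r \<in> {1..n}. real (\<pi> i) - real r > D}"
    using k r by auto
  then have "\<pi> i - 1 - k \<le> card {r \<in> {1..n}. real (\<pi> i) - real r > D}"
    using card_mono[of "{r \<in> {1..n}. real (\<pi> i) - real r > D}" "{1..\<pi> i - 1 - k}"] by simp
  also have "\<dots> = card {j \<in> {1..n}. real (\<pi> i) - real (\<pi> j) > D}"
    using card_rank_eq[OF p, of "\<lambda>r. real (\<pi> i) - real r > D"] by simp
  also have "\<dots> \<le> card {j \<in> {1..n}. \<sigma> j < \<sigma> i}"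
    using ord i by (intro card_mono) auto
  also have "\<dots> = card {r \<in> {1..n}. r < \<sigma> i}"
    using card_rank_eq[OF s, of "\<lambda>r. r < \<sigma> i"] by simp
  also have "{r \<in> {1..n}. r < \<sigma> i} = {1..<\<sigma> i}" using r by auto
  finally have lo: "\<pi> i - 1 - k \<le> \<sigma> i - 1" by simp
  have "{\<pi> i + 1 + k..n} \<subseteq> {r \<in> {1..n}. real r - real (\<pi> i) > D}"
    using k r by auto
  then have "n - (\<pi> i + k) \<le> card {r \<in> {1..n}. real r - real (\<pi> i) > D}"
    using card_mono[of "{r \<in> {1..n}. real r - real (\<pi> i) > D}" "{\<pi> i + 1 + k..n}"] by simp
  also have "\<dots> = card {j \<in> {1..n}. real (\<pi> j) - real (\<pi> i) > D}"
    using card_rank_eq[OF p, of "\<lambda>r. real r - real (\<pi> i) > D"] by simp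
  also have "\<dots> \<le> card {j \<in> {1..n}. \<sigma> i < \<sigma> j}"
    using ord i by (intro card_mono) auto
  also have "\<dots> = card {r \<in> {1..n}. \<sigma> i < r}"
    using card_rank_eq[OF s, of "\<lambda>r. \<sigma> i < r"] by simp
  also have "{r \<in> {1..n}. \<sigma> i < r} = {\<sigma> i<..n}" using r by auto
  finally have hi: "n - (\<pi> i + k) \<le> n - \<sigma> i" by simp
  have "\<pi> i \<le> \<sigma> i + k" using lo r by arith
  moreover have "\<sigma> i \<le> \<pi> i + k" using hi r by arith
  ultimately have "real (\<pi> i) \<le> real (\<sigma> i) + real k" "real (\<sigma> i) \<le> real (\<pi> i) + real k"
    by linarith+
  then show ?thesis using k by (simp add: abs_le_iff)
qed

lemma approx_sorted_linf_dist:
  assumes p: "\<pi> permutes {1..n}" and s: "\<sigma> permutes {1..n}" and D: "0 \<le> D" and n: "1 \<le> n"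
    and ord: "\<And>i j. i \<in> {1..n} \<Longrightarrow> j \<in> {1..n} \<Longrightarrow> real (\<pi> i) - real (\<pi> j) > D \<Longrightarrow> \<sigma> j < \<sigma> i"
  shows "linf_dist n \<sigma> \<pi> \<le> D"
  unfolding linf_dist_def using approx_sorted_dist[OF p s D ord] n by (subst Max_le_iff) auto

lemma approx_sorted_kt_dist:
  assumes p: "\<pi> permutes {1..n}" and D: "0 \<le> D"
    and ord: "\<And>i j. i \<in> {1..n} \<Longrightarrow> j \<in> {1..n} \<Longrightarrow> real (\<pi> i) - real (\<pi> j) > D \<Longrightarrow> \<sigma> j < \<sigma> i"
  shows "kt_dist n \<sigma> \<pi> \<le> real n * D"
proof -
  define k where "k = nat \<lfloor>D\<rfloor>"
  have k: "real k \<le> D" "D < real k + 1" using D unfolding k_def by linarith+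
  have "kt_dist n \<sigma> \<pi> \<le>
      (\<Sum>(i, j) \<in> {(i, j) \<in> {1..n} \<times> {1..n}. \<pi> i < \<pi> j}. of_bool (\<pi> j \<in> {\<pi> i<..\<pi> i + k}))"
    unfolding kt_dist_def
  proof (intro sum_mono, clarify)
    fix i j assume ij: "i \<in> {1..n}" "j \<in> {1..n}" "\<pi> i < \<pi> j"
    have "\<pi> j \<in> {\<pi> i<..\<pi> i + k}" if "\<sigma> j < \<sigma> i"
    proof -
      have "\<not> real (\<pi> j) - real (\<pi> i) > D" using ord[OF ij(2,1)] that by auto
      then show ?thesis using ij k by auto
    qed
    then show "(of_bool (\<sigma> j < \<sigma> i) :: real) \<le> of_bool (\<pi> j \<in> {\<pi> i<..\<pi> i + k})" by auto
  qed
  also have "\<dots> \<le> (\<Sum>(i, j) \<in> {1..n} \<times> {1..n}. of_bool (\<pi> j \<in> {\<pi> i<..\<pi> i + k}))"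
    by (intro sum_mono2) auto
  also have "\<dots> = (\<Sum>i\<in>{1..n}. \<Sum>j\<in>{1..n}. of_bool (\<pi> j \<in> {\<pi> i<..\<pi> i + k}))"
    by (rule sum.cartesian_product[symmetric])
  also have "\<dots> \<le> (\<Sum>i\<in>{1..n}. real k)"
  proof (intro sum_mono)
    fix i
    have "(\<Sum>j\<in>{1..n}. of_bool (\<pi> j \<in> {\<pi> i<..\<pi> i + k})) =
        real (card {j \<in> {1..n}. \<pi> j \<in> {\<pi> i<..\<pi> i + k}})"
      by (simp add: of_bool_def sum.If_cases Int_def)
    also have "card {j \<in> {1..n}. \<pi> j \<in> {\<pi> i<..\<pi> i + k}} = card {r \<in> {1..n}. r \<in> {\<pi> i<..\<pi> i + k}}"
      by (rule card_rank_eq[OF p])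
    also have "\<dots> \<le> card {\<pi> i<..\<pi> i + k}" by (intro card_mono) auto
    finally show "(\<Sum>j\<in>{1..n}. of_bool (\<pi> j \<in> {\<pi> i<..\<pi> i + k})) \<le> real k" by simp
  qed
  also have "\<dots> \<le> real n * D" using k by (simp add: mult_left_mono)
  finally show ?thesis .
qed

lemma approx_sorted_dists:
  assumes p: "\<pi> permutes {1..n}" and s: "\<sigma> permutes {1..n}" and n: "1 \<le> n" and D: "0 \<le> D"
    and ord: "\<And>i j. i \<in> {1..n} \<Longrightarrow> j \<in> {1..n} \<Longrightarrow> real (\<pi> i) - real (\<pi> j) > E \<Longrightarrow> \<sigma> j < \<sigma> i"
    and E: "E \<le> D \<or> E < 1"
  shows "linf_dist n \<sigma> \<pi> \<le> D \<and> kt_dist n \<sigma> \<pi> \<le> real n * D"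
proof -
  have ord': "\<sigma> j < \<sigma> i" if "i \<in> {1..n}" "j \<in> {1..n}" "real (\<pi> i) - real (\<pi> j) > D" for i j
  proof -
    have "\<pi> j < \<pi> i" using that(3) D by linarith
    then have "real (\<pi> i) - real (\<pi> j) \<ge> 1" by linarith
    then have "real (\<pi> i) - real (\<pi> j) > E" using that(3) E by linarith
    then show ?thesis using ord that by blast
  qed
  show ?thesis
    using approx_sorted_linf_dist[of \<pi> n \<sigma> D] approx_sorted_kt_dist[of \<pi> n D \<sigma>] p s D n ord'
    by blast
qed

lemma card_window_le:
  assumes p: "\<pi> permutes {1..n}" and d: "0 \<le> d"
    and W: "W \<subseteq> {j \<in> {1..n}. \<bar>real (\<pi> j) - real (\<pi> i)\<bar> \<le> d}"
  shows "real (card W) \<le> 1 + 2 * real_of_int \<lfloor>d\<rfloor>"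
proof -
  define k where "k = nat \<lfloor>d\<rfloor>"
  have k: "real k = \<lfloor>d\<rfloor>" "real k \<le> d" "d < real k + 1" using d unfolding k_def by linarith+
  have "card W \<le> card {j \<in> {1..n}. \<bar>real (\<pi> j) - real (\<pi> i)\<bar> \<le> d}"
    using W by (intro card_mono) auto
  also have "\<dots> = card {r \<in> {1..n}. \<bar>real r - real (\<pi> i)\<bar> \<le> d}"
    by (rule card_rank_eq[OF p])
  also have "\<dots> \<le> card {\<pi> i - k..\<pi> i + k}"
  proof (intro card_mono subsetI)
    fix r assume "r \<in> {r \<in> {1..n}. \<bar>real r - real (\<pi> i)\<bar> \<le> d}"
    then have "\<bar>real r - real (\<pi> i)\<bar> \<le> d" by simp
    then have "real r < real (\<pi> i) + real k + 1" "real (\<pi> i) < real r + real k + 1"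
      using k(3) by linarith+
    then have "r \<le> \<pi> i + k" "\<pi> i \<le> r + k" by linarith+
    then show "r \<in> {\<pi> i - k..\<pi> i + k}" by simp
  qed simp
  also have "\<dots> \<le> 1 + 2 * k" by auto
  finally show ?thesis unfolding k(1)[symmetric] by linarith
qed

lemma card_window_ge:
  assumes p: "\<pi> permutes {1..n}" and d: "0 \<le> d" and i: "i \<in> {1..n}"
    and W: "{j \<in> {1..n}. \<bar>real (\<pi> j) - real (\<pi> i)\<bar> \<le> d} \<subseteq> W" and fin: "finite W"
  shows "real n / 2 \<le> real (card W) \<or> max 1 d \<le> real (card W)"
proof -
  define k where "k = nat \<lfloor>d\<rfloor>"
  have k: "real k \<le> d" "d < real k + 1" using d unfolding k_def by linarith+
  note r = permutes_range[OF p i]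
  have "{max 1 (\<pi> i - k)..min n (\<pi> i + k)} \<subseteq> {r \<in> {1..n}. \<bar>real r - real (\<pi> i)\<bar> \<le> d}"
  proof
    fix r assume r: "r \<in> {max 1 (\<pi> i - k)..min n (\<pi> i + k)}"
    then have "r \<le> \<pi> i + k" "\<pi> i \<le> r + k" by auto
    then have "real r \<le> real (\<pi> i) + real k" "real (\<pi> i) \<le> real r + real k" by linarith+
    then have "\<bar>real r - real (\<pi> i)\<bar> \<le> d" using k(1) by (simp add: abs_le_iff)
    then show "r \<in> {r \<in> {1..n}. \<bar>real r - real (\<pi> i)\<bar> \<le> d}" using r by simp
  qed
  then have "card {max 1 (\<pi> i - k)..min n (\<pi> i + k)} \<le> card {r \<in> {1..n}. \<bar>real r - real (\<pi> i)\<bar> \<le> d}"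
    by (intro card_mono) auto
  also have "\<dots> = card {j \<in> {1..n}. \<bar>real (\<pi> j) - real (\<pi> i)\<bar> \<le> d}"
    using card_rank_eq[OF p, of "\<lambda>r. \<bar>real r - real (\<pi> i)\<bar> \<le> d"] by simp
  also have "\<dots> \<le> card W" using W fin by (intro card_mono) auto
  finally have "Suc (min n (\<pi> i + k)) - max 1 (\<pi> i - k) \<le> card W" by simp
  then have "n \<le> 2 * card W \<or> Suc k \<le> card W" using r by linarith
  then show ?thesis using k by auto
qed

section \<open>One stage of the algorithm\<close>

definition ms_sound :: "nat \<Rightarrow> (nat \<Rightarrow> nat) \<Rightarrow> ms_state \<Rightarrow> nat \<Rightarrow> bool" where
  "ms_sound n \<pi> P i \<longleftrightarrow>
     (case P i of (I, L, U) \<Rightarrow> I \<union> L \<union> U = {1..n} \<and> I \<inter> L = {} \<and> I \<inter> U = {} \<and> L \<inter> U = {} \<and>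
        i \<in> I \<and> (\<forall>j\<in>L. \<pi> j < \<pi> i) \<and> (\<forall>j\<in>U. \<pi> i < \<pi> j))"

text \<open>
  The scores of \<open>i\<close> and \<open>j\<close> are compared with the threshold of \<open>i\<close> alone, so the noise in the score
  of \<open>j\<close> must be controlled by \<open>|I(i)|\<close>. Only sets above the threshold \<open>\<beta>\<close> are updated, hence the
  guard.
\<close>

definition ms_balanced :: "nat \<Rightarrow> real \<Rightarrow> ms_state \<Rightarrow> bool" where
  "ms_balanced n \<beta> P \<longleftrightarrow> (\<forall>i\<in>{1..n}. \<forall>j\<in>{1..n}. \<beta> \<le> real (card (fst (P i))) \<longrightarrow>
     card (fst (P j)) \<le> 49 * card (fst (P i)))"

definition ms_beta :: "nat \<Rightarrow> nat \<Rightarrow> nat \<Rightarrow> real" where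
  "ms_beta n N T = (real n)\<^sup>2 * (real T / real N) * log 2 (real n * real T)"

lemma ms_soundD:
  assumes "ms_sound n \<pi> P i"
  shows "fst (P i) \<subseteq> {1..n}" "i \<in> fst (P i)" "finite (fst (P i))" "1 \<le> card (fst (P i))"
    "card (fst (P i)) \<le> n"
proof -
  show *: "fst (P i) \<subseteq> {1..n}" "i \<in> fst (P i)"
    using assms unfolding ms_sound_def by (auto split: prod.splits)
  then show **: "finite (fst (P i))" using finite_subset by blast
  have "card (fst (P i)) \<noteq> 0" using * ** by auto
  then show "1 \<le> card (fst (P i))" by linarith
  show "card (fst (P i)) \<le> n" using card_mono[OF _ *(1)] by simp
qed

lemma ms_update_frozen:
  assumes "real (card (fst (P i))) < ms_beta n N T"
  shows "ms_update C0 1 n N T lh A P i = P i"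
  using assms unfolding ms_update_def ms_beta_def by (cases "P i") simp

lemma ms_update_active:
  fixes P n N T lh A C0
  defines "S \<equiv> ms_score n N T lh A P"
  assumes "ms_beta n N T \<le> real (card (fst (P i)))"
  defines "\<tau> \<equiv> (10 + 2 * C0) * sqrt (real (card (fst (P i))) * ms_beta n N T)"
  defines "L \<equiv> {j \<in> {1..n}. S j - S i < - \<tau>}"
  defines "U \<equiv> {j \<in> {1..n}. S j - S i > \<tau>}"
  shows "ms_update C0 1 n N T lh A P i = ({1..n} - (L \<union> U), L, U)"
proof -
  have "real n * sqrt (real (card I) * real T / real N * log 2 (real n * real T)) =
      sqrt (real (card I) * ms_beta n N T)" for I :: "nat set"
  proof -
    have "real n * sqrt (real (card I) * real T / real N * log 2 (real n * real T)) =
        sqrt ((real n)\<^sup>2 * (real (card I) * real T / real N * log 2 (real n * real T)))"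
      by (simp only: real_sqrt_mult[of "(real n)\<^sup>2"] real_sqrt_abs abs_of_nat)
    then show ?thesis by (simp add: ms_beta_def mult_ac)
  qed
  then show ?thesis
    using assms(2) unfolding ms_update_def S_def \<tau>_def L_def U_def ms_beta_def[symmetric]
    by (cases "P i") (simp add: Let_def ms_beta_def mult.assoc)
qed

lemma ms_update_window:
  fixes P n N T lh A
  defines "S \<equiv> ms_score n N T lh A P" and "\<beta> \<equiv> ms_beta n N T"
  defines "P' \<equiv> ms_update 500 1 n N T lh A P"
  assumes \<beta>: "0 \<le> \<beta>" and s: "0 < s" and bal: "ms_balanced n \<beta> P"
    and err: "\<And>j. j \<in> {1..n} \<Longrightarrow>
      \<bar>S j - (a + 2 * s * real (\<pi> j))\<bar> \<le> 61 * sqrt (max (real (card (fst (P j)))) \<beta> * \<beta>)"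
    and i: "i \<in> {1..n}" and act: "\<beta> \<le> real (card (fst (P i)))"
  defines "d \<equiv> 505 * sqrt (real (card (fst (P i))) * \<beta>) / (2 * s)"
  shows "ms_sound n \<pi> P' i"
    and "{j \<in> {1..n}. \<bar>real (\<pi> j) - real (\<pi> i)\<bar> \<le> d} \<subseteq> fst (P' i)"
    and "fst (P' i) \<subseteq> {j \<in> {1..n}. \<bar>real (\<pi> j) - real (\<pi> i)\<bar> \<le> 3 * d}"
proof -
  define q where "q = sqrt (real (card (fst (P i))) * \<beta>)"
  have q: "0 \<le> q" using \<beta> unfolding q_def by simp
  have q': "sqrt (max (real (card (fst (P j)))) \<beta> * \<beta>) \<le> 7 * q" if "j \<in> {1..n}" for j
  proof -
    have "real (card (fst (P j))) \<le> real (49 * card (fst (P i)))"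
      using bal i act that unfolding ms_balanced_def by (subst of_nat_le_iff) blast
    then have "max (real (card (fst (P j)))) \<beta> \<le> 49 * real (card (fst (P i)))"
      using act by simp
    from mult_right_mono[OF this \<beta>]
    have "max (real (card (fst (P j)))) \<beta> * \<beta> \<le> 7\<^sup>2 * (real (card (fst (P i))) * \<beta>)"
      by simp
    then have "sqrt (max (real (card (fst (P j)))) \<beta> * \<beta>) \<le> sqrt (7\<^sup>2 * (real (card (fst (P i))) * \<beta>))"
      by (rule real_sqrt_le_mono)
    then show ?thesis unfolding q_def by (simp add: real_sqrt_mult)
  qed
  have qi: "sqrt (max (real (card (fst (P i)))) \<beta> * \<beta>) = q"
    using act unfolding q_def by simp
  define x where "x j = 2 * s * (real (\<pi> j) - real (\<pi> i))" for j
  have x: "\<bar>S j - S i - x j\<bar> \<le> 488 * q" if "j \<in> {1..n}" for j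
  proof -
    have x_eq: "x j = 2 * s * real (\<pi> j) - 2 * s * real (\<pi> i)"
      unfolding x_def by (simp add: algebra_simps)
    have "\<bar>S j - (a + 2 * s * real (\<pi> j))\<bar> \<le> 427 * q" using err[OF that] q'[OF that] by linarith
    moreover have "\<bar>S i - (a + 2 * s * real (\<pi> i))\<bar> \<le> 61 * q" using err[OF i] qi by simp
    ultimately show ?thesis using x_eq by linarith
  qed
  have x_le: "\<bar>real (\<pi> j) - real (\<pi> i)\<bar> \<le> u * q / (2 * s) \<longleftrightarrow> \<bar>x j\<bar> \<le> u * q" for j u
  proof -
    have "\<bar>x j\<bar> = 2 * s * \<bar>real (\<pi> j) - real (\<pi> i)\<bar>"
      using s unfolding x_def by (simp add: abs_mult)
    then show ?thesis using s by (simp add: pos_le_divide_eq mult.commute)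
  qed
  have x_neg: "x j < 0 \<Longrightarrow> \<pi> j < \<pi> i" "x j > 0 \<Longrightarrow> \<pi> i < \<pi> j" for j
    using s unfolding x_def by (auto simp: mult_less_0_iff zero_less_mult_iff)
  define L where "L = {j \<in> {1..n}. S j - S i < - (1010 * q)}"
  define U where "U = {j \<in> {1..n}. S j - S i > 1010 * q}"
  have P': "P' i = ({1..n} - (L \<union> U), L, U)"
    using ms_update_active[of n N T P i 500 lh A] act
    unfolding P'_def \<beta>_def S_def q_def L_def U_def by simp
  have "\<pi> j < \<pi> i" if "j \<in> L" for j
    using that x[of j] q x_neg(1)[of j] unfolding L_def by auto
  moreover have "\<pi> i < \<pi> j" if "j \<in> U" for j
    using that x[of j] q x_neg(2)[of j] unfolding U_def by auto
  moreover have "i \<notin> L" "i \<notin> U" "L \<subseteq> {1..n}" "U \<subseteq> {1..n}" using q unfolding L_def U_def by auto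
  moreover have "L \<inter> U = {}" using q unfolding L_def U_def by auto
  ultimately show "ms_sound n \<pi> P' i"
    unfolding ms_sound_def P' using i by auto
  show "{j \<in> {1..n}. \<bar>real (\<pi> j) - real (\<pi> i)\<bar> \<le> d} \<subseteq> fst (P' i)"
  proof clarify
    fix j assume j: "j \<in> {1..n}" "\<bar>real (\<pi> j) - real (\<pi> i)\<bar> \<le> d"
    then have "\<bar>x j\<bar> \<le> 505 * q" using x_le[of j 505] unfolding d_def q_def by simp
    then show "j \<in> fst (P' i)"
      using x[OF j(1)] j(1) q unfolding P' L_def U_def by (auto simp: abs_le_iff)
  qed
  show "fst (P' i) \<subseteq> {j \<in> {1..n}. \<bar>real (\<pi> j) - real (\<pi> i)\<bar> \<le> 3 * d}"
  proof
    fix j assume "j \<in> fst (P' i)"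
    then have j: "j \<in> {1..n}" "\<bar>S j - S i\<bar> \<le> 1010 * q"
      unfolding P' L_def U_def by (auto simp: abs_le_iff)
    have "\<bar>x j\<bar> \<le> 1515 * q" using x[OF j(1)] j(2) q by linarith
    then show "j \<in> {j \<in> {1..n}. \<bar>real (\<pi> j) - real (\<pi> i)\<bar> \<le> 3 * d}"
      using x_le[of j 1515] j(1) unfolding d_def q_def by simp
  qed
qed

lemma ms_update_step:
  fixes P n N T lh A
  defines "S \<equiv> ms_score n N T lh A P" and "\<beta> \<equiv> ms_beta n N T"
  defines "P' \<equiv> ms_update 500 1 n N T lh A P"
  assumes \<pi>: "\<pi> permutes {1..n}" and \<beta>: "0 \<le> \<beta>" and s: "0 < s"
    and sound: "\<And>i. i \<in> {1..n} \<Longrightarrow> ms_sound n \<pi> P i" and bal: "ms_balanced n \<beta> P"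
    and err: "\<And>j. j \<in> {1..n} \<Longrightarrow>
      \<bar>S j - (a + 2 * s * real (\<pi> j))\<bar> \<le> 61 * sqrt (max (real (card (fst (P j)))) \<beta> * \<beta>)"
    and X: "\<And>i. i \<in> {1..n} \<Longrightarrow> real (card (fst (P i))) \<le> X"
  shows "i \<in> {1..n} \<Longrightarrow> ms_sound n \<pi> P' i"
    and "ms_balanced n \<beta> P'"
    and "i \<in> {1..n} \<Longrightarrow>
      real (card (fst (P' i))) \<le> max 1 (max \<beta> (4545 / (2 * s) * sqrt (X * \<beta>)))"
proof -
  define d where "d i = 505 * sqrt (real (card (fst (P i))) * \<beta>) / (2 * s)" for i
  have d0: "0 \<le> d i" for i using \<beta> s unfolding d_def by simp
  have frozen: "P' i = P i" if "real (card (fst (P i))) < \<beta>" for i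
    using ms_update_frozen that unfolding P'_def \<beta>_def by simp
  note window = ms_update_window[of n N T s P lh A a \<pi>, folded S_def \<beta>_def P'_def,
      OF \<beta> s bal err, folded d_def]
  show sound': "ms_sound n \<pi> P' i" if "i \<in> {1..n}" for i
  proof (cases "real (card (fst (P i))) < \<beta>")
    case True
    then show ?thesis using sound[OF that] frozen unfolding ms_sound_def by simp
  next
    case False
    then show ?thesis using window(1)[OF _ that] by simp
  qed
  show "real (card (fst (P' i))) \<le> max 1 (max \<beta> (4545 / (2 * s) * sqrt (X * \<beta>)))"
    if i: "i \<in> {1..n}"
  proof (cases "real (card (fst (P i))) < \<beta>")
    case True
    then show ?thesis using frozen by simp
  next
    case False
    have le: "real (card (fst (P' i))) \<le> 1 + 2 * real_of_int \<lfloor>3 * d i\<rfloor>"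
      using card_window_le[OF \<pi>, of "3 * d i"] d0[of i] window(3)[OF _ i] False by simp
    have "9 * d i = 4545 / (2 * s) * sqrt (real (card (fst (P i))) * \<beta>)"
      unfolding d_def by simp
    also have "\<dots> \<le> 4545 / (2 * s) * sqrt (X * \<beta>)"
      using X[OF i] s \<beta> by (intro mult_left_mono real_sqrt_le_mono mult_right_mono) auto
    finally have *: "9 * d i \<le> 4545 / (2 * s) * sqrt (X * \<beta>)" .
    show ?thesis
    proof (cases "3 * d i < 1")
      case True
      then have "\<lfloor>3 * d i\<rfloor> = 0" using d0[of i] by linarith
      then show ?thesis using le by simp
    next
      case False
      then have "1 + 2 * real_of_int \<lfloor>3 * d i\<rfloor> \<le> 9 * d i" by linarith
      then show ?thesis using le * by linarith
    qed
  qed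
  show "ms_balanced n \<beta> P'"
    unfolding ms_balanced_def
  proof (intro ballI impI)
    fix i j assume i: "i \<in> {1..n}" and j: "j \<in> {1..n}" and big: "\<beta> \<le> real (card (fst (P' i)))"
    have act: "\<beta> \<le> real (card (fst (P i)))"
      using big frozen[of i] by (cases "real (card (fst (P i))) < \<beta>") auto
    note wi = window[OF _ i act]
    have lo: "real n / 2 \<le> real (card (fst (P' i))) \<or> max 1 (d i) \<le> real (card (fst (P' i)))"
      using card_window_ge[OF \<pi> d0 i wi(2)] ms_soundD(3)[OF sound'[OF i]] by blast
    show "card (fst (P' j)) \<le> 49 * card (fst (P' i))"
    proof (cases "real (card (fst (P j))) < \<beta>")
      case True
      then show ?thesis using frozen[of j] big by simp
    next
      case False
      have "real (card (fst (P j))) \<le> real (49 * card (fst (P i)))"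
        using bal i j act unfolding ms_balanced_def by (subst of_nat_le_iff) blast
      from mult_right_mono[OF this \<beta>]
      have "real (card (fst (P j))) * \<beta> \<le> 7\<^sup>2 * (real (card (fst (P i))) * \<beta>)"
        by simp
      then have "sqrt (real (card (fst (P j))) * \<beta>) \<le> sqrt (7\<^sup>2 * (real (card (fst (P i))) * \<beta>))"
        by (rule real_sqrt_le_mono)
      then have "sqrt (real (card (fst (P j))) * \<beta>) \<le> 7 * sqrt (real (card (fst (P i))) * \<beta>)"
        by (simp add: real_sqrt_mult)
      then have "d j \<le> 7 * d i" using s unfolding d_def by (simp add: field_simps)
      moreover have "real (card (fst (P' j))) \<le> 1 + 2 * real_of_int \<lfloor>3 * d j\<rfloor>"
        using card_window_le[OF \<pi>, of "3 * d j"] d0[of j] window(3)[OF _ j] False by simp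
      ultimately have "real (card (fst (P' j))) \<le> 1 + 42 * d i" by linarith
      moreover have "real (card (fst (P' j))) \<le> real n"
        using ms_soundD(5)[OF sound'[OF j]] by simp
      ultimately have "real (card (fst (P' j))) \<le> 49 * real (card (fst (P' i)))"
        using lo by linarith
      then show ?thesis by linarith
    qed
  qed
qed

definition ms_noise_ok :: "nat \<Rightarrow> nat \<Rightarrow> nat \<Rightarrow> real \<Rightarrow> (nat \<Rightarrow> nat) \<Rightarrow> (nat \<Rightarrow> nat \<Rightarrow> nat) \<Rightarrow> ms_state \<Rightarrow> bool"
  where "ms_noise_ok n N T lam \<pi> A P \<longleftrightarrow> (\<forall>i\<in>{1..n}.
    \<bar>real T * real n * (real n - 1) / (2 * real N) * (\<Sum>j\<in>fst (P i). real (A i j))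
      - (\<Sum>j\<in>fst (P i) - {i}. noisy_matrix lam (\<pi> i) (\<pi> j))\<bar>
    \<le> 10 * sqrt (max (real (card (fst (P i)))) (ms_beta n N T) * ms_beta n N T))"

text \<open>The slope is \<open>lh\<close>, not \<open>lam\<close>: thus the error of \<open>lh\<close> enters only through the \<open>|I(i)| - 1\<close>
  items that are not yet separated from \<open>i\<close>.\<close>

lemma ms_score_error:
  assumes \<pi>: "\<pi> permutes {1..n}" and i: "i \<in> {1..n}" and sound: "ms_sound n \<pi> P i"
    and noise: "\<bar>real T * real n * (real n - 1) / (2 * real N) * (\<Sum>j\<in>fst (P i). real (A i j))
      - (\<Sum>j\<in>fst (P i) - {i}. noisy_matrix lam (\<pi> i) (\<pi> j))\<bar> \<le> e"
  shows "\<bar>ms_score n N T lh A P i - (((real n - 1) / 2 - lh * (real n + 1)) + 2 * lh * real (\<pi> i))\<bar>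
    \<le> e + \<bar>lh - lam\<bar> * (real (card (fst (P i))) - 1)"
proof -
  obtain I L U where P: "P i = (I, L, U)" by (cases "P i") auto
  have un: "I \<union> L \<union> U = {1..n}" and dj: "I \<inter> L = {}" "I \<inter> U = {}" "L \<inter> U = {}" and iI: "i \<in> I"
    and L: "\<And>j. j \<in> L \<Longrightarrow> \<pi> j < \<pi> i" and U: "\<And>j. j \<in> U \<Longrightarrow> \<pi> i < \<pi> j"
    using sound unfolding ms_sound_def P by auto
  have sub: "I \<subseteq> {1..n}" "L \<subseteq> {1..n}" "U \<subseteq> {1..n}" using un by auto
  then have fin: "finite I" "finite L" "finite U" using finite_subset by blast+
  have inj: "inj \<pi>" using permutes_inj[OF \<pi>] .
  define Ia where "Ia = {j \<in> I. \<pi> j < \<pi> i}"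
  define Ib where "Ib = {j \<in> I. \<pi> i < \<pi> j}"
  have ne: "\<pi> j < \<pi> i \<or> \<pi> i < \<pi> j" if "j \<noteq> i" for j
    using injD[OF inj, of i j] that by (metis nat_neq_iff)
  have Iab: "I - {i} = Ia \<union> Ib" "Ia \<inter> Ib = {}" "finite Ia" "finite Ib"
    unfolding Ia_def Ib_def using fin ne by auto
  note r = permutes_range[OF \<pi> i]
  have "Ia \<union> L = {j \<in> {1..n}. \<pi> j < \<pi> i}"
    unfolding Ia_def using un L U by fastforce
  then have "card (Ia \<union> L) = card {r \<in> {1..n}. r < \<pi> i}"
    using card_rank_eq[OF \<pi>, of "\<lambda>r. r < \<pi> i"] by simp
  also have "{r \<in> {1..n}. r < \<pi> i} = {1..<\<pi> i}" using r by auto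
  finally have "card Ia + card L = \<pi> i - 1"
    using dj Iab fin unfolding Ia_def by (subst (asm) card_Un_disjoint) auto
  then have a: "real (card Ia) + real (card L) = real (\<pi> i) - 1" using r by linarith
  have "Ib \<union> U = {j \<in> {1..n}. \<pi> i < \<pi> j}"
    unfolding Ib_def using un L U by fastforce
  then have "card (Ib \<union> U) = card {r \<in> {1..n}. \<pi> i < r}"
    using card_rank_eq[OF \<pi>, of "\<lambda>r. \<pi> i < r"] by simp
  also have "{r \<in> {1..n}. \<pi> i < r} = {\<pi> i<..n}" using r by auto
  finally have "card Ib + card U = n - \<pi> i"
    using dj Iab fin unfolding Ib_def by (subst (asm) card_Un_disjoint) auto
  then have b: "real (card Ib) + real (card U) = real n - real (\<pi> i)" using r by linarith
  have "(\<Sum>j\<in>I - {i}. noisy_matrix lam (\<pi> i) (\<pi> j)) =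
      (\<Sum>j\<in>Ia. noisy_matrix lam (\<pi> i) (\<pi> j)) + (\<Sum>j\<in>Ib. noisy_matrix lam (\<pi> i) (\<pi> j))"
    unfolding Iab(1) using Iab by (intro sum.union_disjoint)
  also have "(\<Sum>j\<in>Ia. noisy_matrix lam (\<pi> i) (\<pi> j)) = (\<Sum>j\<in>Ia. 1/2 + lam)"
    by (intro sum.cong) (auto simp: Ia_def noisy_matrix_def)
  also have "(\<Sum>j\<in>Ib. noisy_matrix lam (\<pi> i) (\<pi> j)) = (\<Sum>j\<in>Ib. 1/2 - lam)"
    by (intro sum.cong) (auto simp: Ib_def noisy_matrix_def)
  finally have M: "(\<Sum>j\<in>I - {i}. noisy_matrix lam (\<pi> i) (\<pi> j)) =
      real (card Ia) * (1/2 + lam) + real (card Ib) * (1/2 - lam)" by simp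
  have "card Ia + card Ib = card (I - {i})"
    unfolding Iab(1) using Iab by (simp add: card_Un_disjoint)
  moreover have "card I = Suc (card (I - {i}))" using iI fin(1) by (metis card.remove)
  ultimately have cI: "real (card Ia) + real (card Ib) = real (card I) - 1" by linarith
  define W where "W = real T * real n * (real n - 1) / (2 * real N) * (\<Sum>j\<in>I. real (A i j))"
  have S: "ms_score n N T lh A P i = W + real (card L) * (1/2 + lh) + real (card U) * (1/2 - lh)"
    unfolding ms_score_def P W_def by simp
  have noise': "\<bar>W - (real (card Ia) * (1/2 + lam) + real (card Ib) * (1/2 - lam))\<bar> \<le> e"
    using noise unfolding P M[symmetric] W_def by simp
  have cL: "real (card L) = real (\<pi> i) - 1 - real (card Ia)"
    and cU: "real (card U) = real n - real (\<pi> i) - real (card Ib)" using a b by linarith+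
  have "ms_score n N T lh A P i - (((real n - 1) / 2 - lh * (real n + 1)) + 2 * lh * real (\<pi> i))
      = (W - (real (card Ia) * (1/2 + lam) + real (card Ib) * (1/2 - lam)))
        - (lh - lam) * (real (card Ia) - real (card Ib))"
    unfolding S cL cU by (simp add: field_simps)
  also have "\<bar>\<dots>\<bar> \<le> e + \<bar>(lh - lam) * (real (card Ia) - real (card Ib))\<bar>"
    using noise' by linarith
  also have "\<bar>(lh - lam) * (real (card Ia) - real (card Ib))\<bar> \<le> \<bar>lh - lam\<bar> * (real (card I) - 1)"
    unfolding abs_mult using cI by (intro mult_left_mono) auto
  finally show ?thesis unfolding P by simp
qed

text \<open>The summand \<open>3 / n\<close> is the bias of the estimate of \<open>\<lambda>\<close> for odd \<open>n\<close>.\<close>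

lemma bias_error_le:
  fixes n k :: nat and \<beta> B :: real
  assumes k: "1 \<le> k" "k \<le> n" and \<beta>: "0 < \<beta>" and B: "0 < B"
    and kB: "real k \<le> max 1 (sqrt (B\<^sup>2 * \<beta> * real n))"
    and n: "9 * B\<^sup>2 \<le> real n \<or> B\<^sup>2 * \<beta> * real n < 1"
  shows "(3 / real n + 50 * sqrt \<beta> / real n) * (real k - 1) \<le> 51 * sqrt (real k * \<beta>)"
proof (cases "k = 1")
  case True
  then show ?thesis using \<beta> by simp
next
  case False
  then have k2: "real k \<ge> 2" using k by simp
  define z where "z = B\<^sup>2 * \<beta> * real n"
  have kz: "real k \<le> sqrt z" using kB k2 unfolding z_def by simp
  then have "1 \<le> sqrt z" using k2 by linarith
  then have z1: "1 \<le> z" by simp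
  then have n9: "9 * B\<^sup>2 \<le> real n" using n unfolding z_def by linarith
  have "sqrt z \<le> z" using z1 by (metis real_sqrt_le_iff real_sqrt_abs2 abs_of_nonneg mult_left_mono
    mult.right_neutral order.trans zero_le_one)
  then have "9 * real k \<le> 9 * z" using kz by linarith
  also have "9 * z = (9 * B\<^sup>2) * (\<beta> * real n)" unfolding z_def by simp
  also have "\<dots> \<le> real n * (\<beta> * real n)" using n9 \<beta> by (intro mult_right_mono) auto
  finally have "real k * (9 * real k) \<le> real k * (real n * (\<beta> * real n))"
    by (intro mult_left_mono) auto
  then have "(3 * real k)\<^sup>2 \<le> (real n)\<^sup>2 * (real k * \<beta>)" by (simp add: power2_eq_square mult_ac)
  then have "sqrt ((3 * real k)\<^sup>2) \<le> sqrt ((real n)\<^sup>2 * (real k * \<beta>))" by (rule real_sqrt_le_mono)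
  then have "3 * real k \<le> real n * sqrt (real k * \<beta>)"
    by (simp add: real_sqrt_mult)
  then have 1: "3 * real k / real n \<le> sqrt (real k * \<beta>)"
    using k by (simp add: divide_le_eq mult.commute)
  have "sqrt (real k) * sqrt (real k) \<le> real n * sqrt (real k)"
  proof (rule mult_right_mono)
    have "sqrt (real k) \<le> sqrt ((real k)\<^sup>2)" using k by (intro real_sqrt_le_mono) (simp add: self_le_power)
    then show "sqrt (real k) \<le> real n" using k by simp
  qed simp
  then have "real k \<le> real n * sqrt (real k)" by simp
  then have "real k / real n \<le> sqrt (real k)"
    using k by (simp add: divide_le_eq mult.commute)
  then have "50 * sqrt \<beta> * (real k / real n) \<le> 50 * sqrt \<beta> * sqrt (real k)"
    using \<beta> by (intro mult_left_mono) auto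
  then have 2: "50 * sqrt \<beta> / real n * real k \<le> 50 * sqrt (real k * \<beta>)"
    by (simp add: real_sqrt_mult mult_ac)
  have "(3 / real n + 50 * sqrt \<beta> / real n) * (real k - 1) \<le> (3 / real n + 50 * sqrt \<beta> / real n) * real k"
    using \<beta> by (intro mult_left_mono) auto
  also have "\<dots> = 3 * real k / real n + 50 * sqrt \<beta> / real n * real k" by (simp add: distrib_right)
  finally show ?thesis using 1 2 by linarith
qed

section \<open>All stages\<close>

lemma sqrt_max_one_powr_le:
  fixes b r e :: real
  assumes b: "0 < b" and r: "1 \<le> r" and e: "0 \<le> e"
  shows "sqrt (max 1 (b * r powr e) * b) \<le> max 1 (b * r powr (e / 2))"
proof (cases "b * r powr e \<le> 1")
  case True
  have "sqrt b \<le> max 1 b"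
    by (cases "b \<le> 1") (auto simp: real_le_lsqrt power2_eq_square intro!: real_le_lsqrt)
  moreover have "b \<le> b * r powr (e / 2)" using b r e by (simp add: ge_one_powr_ge_zero)
  ultimately show ?thesis using True by auto
next
  case False
  have "r powr e = (r powr (e / 2))\<^sup>2"
    using r by (simp add: powr_power)
  then have "max 1 (b * r powr e) * b = (b * r powr (e / 2))\<^sup>2"
    using False by (simp add: power_mult_distrib power2_eq_square mult_ac)
  then show ?thesis using b by simp
qed

lemma ms_sets_stages:
  fixes c lam lh :: real and n N T :: nat and A
  defines "B \<equiv> 5000 / c"
  defines "b \<equiv> B\<^sup>2 * ms_beta n N T"
  defines "Q \<equiv> ms_sets 500 1 n N T lh A"
  assumes \<pi>: "\<pi> permutes {1..n}" and c: "0 < c" "c < 1/2" "c \<le> lam" "c / 2 \<le> lh"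
    and \<beta>: "0 < ms_beta n N T" and bn: "b \<le> real n"
    and n: "9 * B\<^sup>2 \<le> real n \<or> b * real n < 1"
    and noise: "\<And>t. t < T \<Longrightarrow> ms_noise_ok n N T lam \<pi> (A (Suc t)) (Q t)"
    and lh: "\<bar>lh - lam\<bar> \<le> 3 / real n + 50 * sqrt (ms_beta n N T) / real n"
  shows "t \<le> T \<Longrightarrow> (\<forall>i\<in>{1..n}. ms_sound n \<pi> (Q t) i) \<and> ms_balanced n (ms_beta n N T) (Q t) \<and>
      (\<forall>i\<in>{1..n}. real (card (fst (Q t i))) \<le> max 1 (b * (real n / b) powr (1 / 2 ^ t)))"
    and "1 \<le> t \<Longrightarrow> t < T \<Longrightarrow> i \<in> {1..n} \<Longrightarrow>
      \<bar>ms_score n N T lh (A (Suc t)) (Q t) i - (((real n - 1) / 2 - lh * (real n + 1)) + 2 * lh * real (\<pi> i))\<bar>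
        \<le> 61 * sqrt (max (real (card (fst (Q t i)))) (ms_beta n N T) * ms_beta n N T)"
    and "1 \<le> t \<Longrightarrow> t \<le> T \<Longrightarrow> i \<in> {1..n} \<Longrightarrow> real (card (fst (Q t i))) \<le> max 1 (sqrt (b * real n))"
proof -
  define \<beta> where "\<beta> = ms_beta n N T"
  have \<beta>0: "0 < \<beta>" using \<beta> unfolding \<beta>_def .
  have B1: "1 \<le> B" "0 < B" using c unfolding B_def by (simp_all add: field_simps)
  have b0: "0 < b" using B1 \<beta> unfolding b_def by simp
  define r where "r = real n / b"
  have r1: "1 \<le> r" using bn b0 unfolding r_def by simp
  have \<beta>b: "\<beta> \<le> b"
  proof -
    have "1 * \<beta> \<le> B\<^sup>2 * \<beta>" using B1 \<beta>0 by (intro mult_right_mono) auto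
    then show ?thesis unfolding b_def \<beta>_def by simp
  qed
  have br: "b * r powr (1 / 2 ^ t) \<le> sqrt (b * real n)" if "1 \<le> t" for t
  proof -
    have "(2::real) \<le> 2 ^ t" using that by (metis one_le_numeral power_increasing power_one_right)
    then have "1 / 2 ^ t \<le> (1 / 2 :: real)" by (simp add: field_simps)
    then have "b * r powr (1 / 2 ^ t) \<le> b * r powr (1 / 2)"
      using b0 r1 by (intro mult_left_mono powr_mono) auto
    also have "\<dots> = sqrt (b\<^sup>2 * r)" using b0 r1 by (simp add: real_sqrt_mult powr_half_sqrt)
    also have "b\<^sup>2 * r = b * real n" using b0 unfolding r_def by (simp add: power2_eq_square)
    finally show ?thesis .
  qed
  define Inv where "Inv t \<longleftrightarrow> (\<forall>i\<in>{1..n}. ms_sound n \<pi> (Q t) i) \<and> ms_balanced n \<beta> (Q t) \<and>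
      (\<forall>i\<in>{1..n}. real (card (fst (Q t i))) \<le> max 1 (b * r powr (1 / 2 ^ t)))" for t
  have score: "\<bar>ms_score n N T lh (A (Suc t)) (Q t) i -
        (((real n - 1) / 2 - lh * (real n + 1)) + 2 * lh * real (\<pi> i))\<bar>
      \<le> 61 * sqrt (max (real (card (fst (Q t i)))) \<beta> * \<beta>)"
    if "1 \<le> t" "t < T" "i \<in> {1..n}" "Inv t" for t i
  proof -
    define k where "k = card (fst (Q t i))"
    have sound: "ms_sound n \<pi> (Q t) i" using that unfolding Inv_def by blast
    have k: "1 \<le> k" "k \<le> n" using ms_soundD(4,5)[OF sound] unfolding k_def by auto
    have "real k \<le> max 1 (b * r powr (1 / 2 ^ t))" using that unfolding Inv_def k_def by blast
    then have "real k \<le> max 1 (sqrt (B\<^sup>2 * \<beta> * real n))"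
      using br[OF that(1)] unfolding b_def \<beta>_def by linarith
    then have "(3 / real n + 50 * sqrt \<beta> / real n) * (real k - 1) \<le> 51 * sqrt (real k * \<beta>)"
      using bias_error_le[OF k \<beta>0 B1(2)] n unfolding b_def \<beta>_def by blast
    moreover have "\<bar>lh - lam\<bar> * (real k - 1) \<le> (3 / real n + 50 * sqrt \<beta> / real n) * (real k - 1)"
      using lh k unfolding \<beta>_def by (intro mult_right_mono) auto
    moreover have "sqrt (real k * \<beta>) \<le> sqrt (max (real k) \<beta> * \<beta>)"
      using \<beta>0 by (intro real_sqrt_le_mono mult_right_mono) auto
    moreover have "\<bar>ms_score n N T lh (A (Suc t)) (Q t) i -
        (((real n - 1) / 2 - lh * (real n + 1)) + 2 * lh * real (\<pi> i))\<bar>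
        \<le> 10 * sqrt (max (real k) \<beta> * \<beta>) + \<bar>lh - lam\<bar> * (real k - 1)"
      using ms_score_error[OF \<pi> that(3) sound] noise[OF that(2)] that(3)
      unfolding ms_noise_ok_def k_def \<beta>_def by blast
    ultimately show ?thesis unfolding k_def by linarith
  qed
  have next_bound: "max 1 (max \<beta> (4545 / (2 * s) * sqrt (max 1 (b * r powr (1 / 2 ^ t)) * \<beta>)))
      \<le> max 1 (b * r powr (1 / 2 ^ Suc t))" if "c / 2 \<le> s" for s t
  proof -
    define X where "X = max 1 (b * r powr (1 / 2 ^ t))"
    have "4545 / (2 * s) \<le> B" unfolding B_def using c that by (intro frac_le) auto
    then have "4545 / (2 * s) * sqrt (X * \<beta>) \<le> B * sqrt (X * \<beta>)"
      using \<beta>0 unfolding X_def by (intro mult_right_mono) auto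
    also have "\<dots> = sqrt (X * b)" using B1 unfolding b_def \<beta>_def by (simp add: real_sqrt_mult)
    also have "\<dots> \<le> max 1 (b * r powr (1 / 2 ^ t / 2))"
      unfolding X_def using b0 r1 by (intro sqrt_max_one_powr_le) auto
    finally have "4545 / (2 * s) * sqrt (X * \<beta>) \<le> max 1 (b * r powr (1 / 2 ^ Suc t))"
      by (simp add: mult.commute)
    moreover have "b * 1 \<le> b * r powr (1 / 2 ^ Suc t)"
      using b0 r1 by (intro mult_left_mono ge_one_powr_ge_zero) auto
    ultimately show ?thesis using \<beta>b unfolding X_def by auto
  qed
  have step: "Inv (Suc t)" if inv: "Inv t" and s: "c / 2 \<le> s" and err: "\<And>i. i \<in> {1..n} \<Longrightarrow>
      \<bar>ms_score n N T lh (A (Suc t)) (Q t) i - (a + 2 * s * real (\<pi> i))\<bar>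
      \<le> 61 * sqrt (max (real (card (fst (Q t i)))) \<beta> * \<beta>)" for t s a
  proof -
    have Q': "Q (Suc t) = ms_update 500 1 n N T lh (A (Suc t)) (Q t)"
      unfolding Q_def by simp
    have s0: "0 < s" using s c by linarith
    have "\<And>i. i \<in> {1..n} \<Longrightarrow> ms_sound n \<pi> (Q t) i" "ms_balanced n \<beta> (Q t)"
      "\<And>i. i \<in> {1..n} \<Longrightarrow> real (card (fst (Q t i))) \<le> max 1 (b * r powr (1 / 2 ^ t))"
      using inv unfolding Inv_def by blast+
    note upd = ms_update_step[OF \<pi> _ s0 this(1) this(2)[unfolded \<beta>_def] err[unfolded \<beta>_def] this(3),
        folded \<beta>_def Q', OF less_imp_le[OF \<beta>0]]
    show ?thesis unfolding Inv_def
      using upd next_bound[OF s, of t] by (meson order.trans)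
  qed
  have Inv: "Inv t" if "t \<le> T" for t
    using that
  proof (induction t)
    case 0
    have Q0: "Q 0 = (\<lambda>i. ({1..n}, {}, {}))" unfolding Q_def by simp
    have "b * r powr (1 / 2 ^ 0) = real n" using b0 r1 unfolding r_def by simp
    then show ?case unfolding Inv_def Q0 ms_sound_def ms_balanced_def by auto
  next
    case (Suc t)
    then have inv: "Inv t" and tT: "t < T" by auto
    show ?case
    proof (cases "t = 0")
      case False
      then show ?thesis using step[OF inv c(4) score[OF _ tT _ inv]] by simp
    next
      case True
      \<comment> \<open>The scores of the first stage do not involve \<open>lh\<close>, so \<open>lam\<close> may take its place:
        there the bias of the estimate need not be small compared with the noise.\<close>
      have eq: "ms_score n N T lh (A (Suc t)) (Q t) i = ms_score n N T lam (A (Suc t)) (Q t) i" for i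
        unfolding True Q_def ms_score_def by simp
      have err: "\<bar>ms_score n N T lh (A (Suc t)) (Q t) i -
          (((real n - 1) / 2 - lam * (real n + 1)) + 2 * lam * real (\<pi> i))\<bar>
          \<le> 61 * sqrt (max (real (card (fst (Q t i)))) \<beta> * \<beta>)" if i: "i \<in> {1..n}" for i
      proof -
        have "ms_sound n \<pi> (Q t) i" using inv i unfolding Inv_def by blast
        from ms_score_error[OF \<pi> i this, of T N "A (Suc t)" lam
            "10 * sqrt (max (real (card (fst (Q t i)))) \<beta> * \<beta>)" lam]
        have "\<bar>ms_score n N T lh (A (Suc t)) (Q t) i -
          (((real n - 1) / 2 - lam * (real n + 1)) + 2 * lam * real (\<pi> i))\<bar>
          \<le> 10 * sqrt (max (real (card (fst (Q t i)))) \<beta> * \<beta>)"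
          using noise[OF tT] i unfolding ms_noise_ok_def eq \<beta>_def by simp
        moreover have "0 \<le> sqrt (max (real (card (fst (Q t i)))) \<beta> * \<beta>)" using \<beta>0 by simp
        ultimately show ?thesis by linarith
      qed
      have "c / 2 \<le> lam" using c by simp
      then show ?thesis by (rule step[OF inv _ err])
    qed
  qed
  show "t \<le> T \<Longrightarrow> (\<forall>i\<in>{1..n}. ms_sound n \<pi> (Q t) i) \<and> ms_balanced n (ms_beta n N T) (Q t) \<and>
      (\<forall>i\<in>{1..n}. real (card (fst (Q t i))) \<le> max 1 (b * (real n / b) powr (1 / 2 ^ t)))"
    using Inv unfolding Inv_def \<beta>_def r_def by blast
  show "1 \<le> t \<Longrightarrow> t < T \<Longrightarrow> i \<in> {1..n} \<Longrightarrow>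
      \<bar>ms_score n N T lh (A (Suc t)) (Q t) i - (((real n - 1) / 2 - lh * (real n + 1)) + 2 * lh * real (\<pi> i))\<bar>
        \<le> 61 * sqrt (max (real (card (fst (Q t i)))) (ms_beta n N T) * ms_beta n N T)"
    using score Inv unfolding \<beta>_def by simp
  show "real (card (fst (Q t i))) \<le> max 1 (sqrt (b * real n))" if "1 \<le> t" "t \<le> T" "i \<in> {1..n}"
  proof -
    have "real (card (fst (Q t i))) \<le> max 1 (b * r powr (1 / 2 ^ t))"
      using Inv[OF that(2)] that(3) unfolding Inv_def by blast
    then show ?thesis using br[OF that(1)] by linarith
  qed
qed

lemma ms_final_dists:
  fixes c lam lh :: real and n N T :: nat and A
  defines "B \<equiv> 5000 / c"
  defines "b \<equiv> B\<^sup>2 * ms_beta n N T"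
  defines "Q \<equiv> ms_sets 500 1 n N T lh A"
  assumes \<pi>: "\<pi> permutes {1..n}" and c: "0 < c" "c < 1/2" "c \<le> lam" "c / 2 \<le> lh"
    and \<beta>: "0 < ms_beta n N T"
    and n: "9 * B\<^sup>2 \<le> real n \<or> b * real n < 1"
    and noise: "\<And>t. t < T \<Longrightarrow> ms_noise_ok n N T lam \<pi> (A (Suc t)) (Q t)"
    and lh: "\<bar>lh - lam\<bar> \<le> 3 / real n + 50 * sqrt (ms_beta n N T) / real n"
    and T: "2 \<le> T" "log 2 (real n) / 4 \<le> 2 ^ (T - 1)" and n2: "2 \<le> n"
    and srt: "sorting_rule n srt"
  defines "\<sigma> \<equiv> srt (ms_score n N T lh (A T) (Q (T - 1)))"
  shows "linf_dist n \<sigma> \<pi> \<le> b \<and> kt_dist n \<sigma> \<pi> \<le> real n * b"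
proof -
  define \<beta> where "\<beta> = ms_beta n N T"
  define S where "S = ms_score n N T lh (A T) (Q (T - 1))"
  have \<beta>0: "0 < \<beta>" using \<beta> unfolding \<beta>_def .
  have B1: "10000 \<le> B" using c unfolding B_def by (simp add: field_simps)
  have b0: "0 < b" using B1 \<beta> unfolding b_def by simp
  have \<sigma>: "\<sigma> permutes {1..n}" using srt unfolding sorting_rule_def \<sigma>_def by blast
  have n1: "1 \<le> n" using n2 by simp
  show ?thesis
  proof (cases "b \<le> real n")
    case False
    show ?thesis
    proof (rule approx_sorted_dists[OF \<pi> \<sigma> n1, where E = "real n"])
      fix i j assume "i \<in> {1..n}" "real n < real (\<pi> i) - real (\<pi> j)"
      then show "\<sigma> j < \<sigma> i" using permutes_range[OF \<pi>, of i] by linarith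
    qed (use False b0 in auto)
  next
    case True
    note stages = ms_sets_stages[of \<pi> n c lam lh N T A, folded B_def, folded b_def Q_def,
        OF \<pi> c \<beta> True n noise lh]
    have T1: "1 \<le> T - 1" "T - 1 \<le> T" "T - 1 < T" using T(1) by auto
    have card: "real (card (fst (Q (T - 1) i))) \<le> max 1 (256 * b)" if i: "i \<in> {1..n}" for i
    proof (cases "b * real n < 1")
      case True
      then have "sqrt (b * real n) \<le> 1" by simp
      then show ?thesis using stages(3)[OF _ T1(1,2) i] by linarith
    next
      case False
      have L: "0 < log 2 (real n)" using n2 by simp
      have "real n / b \<le> (real n)\<^sup>2" "1 \<le> real n / b"
        using False b0 True n2 mult_left_mono[of 1 "b * real n" "real n"]
        by (simp_all add: divide_le_eq power2_eq_square mult_ac)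
      then have "(real n / b) powr (1 / 2 ^ (T - 1)) \<le> (real n)\<^sup>2 powr (1 / 2 ^ (T - 1))"
        by (intro powr_mono2) auto
      also have "\<dots> \<le> (real n)\<^sup>2 powr (4 / log 2 (real n))"
      proof (rule powr_mono)
        have "1 / 2 ^ (T - 1) \<le> 1 / (log 2 (real n) / 4)"
          using T(2) L by (intro divide_left_mono) auto
        then show "1 / 2 ^ (T - 1) \<le> 4 / log 2 (real n)" by simp
      qed (use n2 in simp)
      also have "(real n)\<^sup>2 = 2 powr (2 * log 2 (real n))"
        using n2 by (simp add: powr_mult powr_powr[symmetric] mult.commute[of 2] powr_numeral)
      also have "(2 powr (2 * log 2 (real n))) powr (4 / log 2 (real n)) = (2::real) powr 8"
        using L unfolding powr_powr by simp
      also have "\<dots> = 256" by simp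
      finally have "b * (real n / b) powr (1 / 2 ^ (T - 1)) \<le> b * 256"
        using b0 by (intro mult_left_mono) auto
      then show ?thesis using stages(1)[OF _ T1(2)] i by fastforce
    qed
    define e where "e = sqrt (max 1 (256 * b) * \<beta>)"
    have e0: "0 \<le> e" using \<beta>0 unfolding e_def by simp
    define a where "a = (real n - 1) / 2 - lh * (real n + 1)"
    have err: "\<bar>S i - (a + 2 * lh * real (\<pi> i))\<bar> \<le> 61 * e" if i: "i \<in> {1..n}" for i
    proof -
      have "\<beta> \<le> b"
      proof -
        have "1 * \<beta> \<le> B\<^sup>2 * \<beta>" using B1 \<beta>0 by (intro mult_right_mono) auto
        then show ?thesis unfolding b_def \<beta>_def by simp
      qed
      then have "max (real (card (fst (Q (T - 1) i)))) \<beta> \<le> max 1 (256 * b)" using card[OF i] b0 by linarith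
      then have "sqrt (max (real (card (fst (Q (T - 1) i)))) \<beta> * \<beta>) \<le> e"
        unfolding e_def using \<beta>0 by (intro real_sqrt_le_mono mult_right_mono) auto
      moreover have "Suc (T - 1) = T" using T(1) by simp
      then have "\<bar>S i - (a + 2 * lh * real (\<pi> i))\<bar> \<le>
          61 * sqrt (max (real (card (fst (Q (T - 1) i)))) \<beta> * \<beta>)"
        using stages(2)[OF _ T1(1,3) i] unfolding S_def a_def \<beta>_def by simp
      ultimately show ?thesis by linarith
    qed
    define E where "E = 122 * e / c"
    have ord: "\<sigma> j < \<sigma> i" if ij: "i \<in> {1..n}" "j \<in> {1..n}" and d: "E < real (\<pi> i) - real (\<pi> j)" for i j
    proof -
      have "122 * e < c * (real (\<pi> i) - real (\<pi> j))"
        using d c unfolding E_def by (simp add: pos_divide_less_eq mult.commute)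
      also have "\<dots> \<le> 2 * lh * (real (\<pi> i) - real (\<pi> j))"
      proof (rule mult_right_mono)
        have "0 \<le> E" using e0 c unfolding E_def by simp
        then show "0 \<le> real (\<pi> i) - real (\<pi> j)" using d by linarith
      qed (use c in simp)
      finally have "S j < S i" using err[OF ij(1)] err[OF ij(2)] unfolding right_diff_distrib by linarith
      then show ?thesis using srt ij unfolding sorting_rule_def \<sigma>_def S_def by blast
    qed
    have B_c: "122 / c \<le> B / 16" unfolding B_def using c by (simp add: field_simps)
    have "E \<le> b \<or> E < 1"
    proof (cases "256 * b \<le> 1")
      case False
      have "max 1 (256 * b) * \<beta> = (16 * B * \<beta>)\<^sup>2"
        using False by (simp add: b_def \<beta>_def power2_eq_square)
      then have "e = 16 * B * \<beta>" unfolding e_def using B1 \<beta>0 by simp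
      then have "E = (122 / c) * (16 * B * \<beta>)" unfolding E_def by simp
      also have "\<dots> \<le> (B / 16) * (16 * B * \<beta>)" using B_c B1 \<beta>0 by (intro mult_right_mono) auto
      also have "\<dots> = b" unfolding b_def \<beta>_def by (simp add: power2_eq_square)
      finally show ?thesis by simp
    next
      case True
      then have "e = sqrt \<beta>" unfolding e_def by (simp add: max_absorb1)
      moreover have "16 * B * sqrt \<beta> \<le> 1"
      proof -
        have "(16 * B * sqrt \<beta>)\<^sup>2 = 256 * b"
          using \<beta>0 by (simp add: power_mult_distrib b_def \<beta>_def)
        then have "(16 * B * sqrt \<beta>)\<^sup>2 \<le> 1\<^sup>2" using True by simp
        then show ?thesis by (rule power2_le_imp_le) simp
      qed
      moreover have "122 / c * sqrt \<beta> \<le> B / 16 * sqrt \<beta>"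
        using B_c \<beta>0 by (intro mult_right_mono) auto
      ultimately have "E \<le> 1 / 256" unfolding E_def by simp
      then show ?thesis by simp
    qed
    from approx_sorted_dists[OF \<pi> \<sigma> n1 _ ord this] b0 show ?thesis by simp
  qed
qed

section \<open>Concentration of adapted counts\<close>

lemma exp_le_quadratic:
  fixes u :: real
  assumes "\<bar>u\<bar> \<le> 1"
  shows "exp u \<le> 1 + u + u\<^sup>2"
proof (cases "0 \<le> u")
  case True
  then show ?thesis using assms exp_bound[of u] by simp
next
  case False
  define v where "v = - u"
  have v: "0 \<le> v" "v \<le> 1" using False assms unfolding v_def by auto
  have "exp (- v) \<le> 1 / (1 + v)"
    using exp_ge_add_one_self[of v] v by (simp add: exp_minus field_simps)
  also have "\<dots> \<le> 1 - v + v\<^sup>2"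
  proof -
    have "(1 - v + v\<^sup>2) * (1 + v) = 1 + v ^ 3"
      by (simp add: algebra_simps power2_eq_square power3_eq_cube)
    then show ?thesis using v by (simp add: divide_le_eq)
  qed
  finally show ?thesis unfolding v_def by simp
qed

lemma hits_mgf_le:
  fixes D :: "'a pmf" and G :: "'a set"
  assumes B: "finite B" and th: "\<bar>th\<bar> \<le> 1"
  defines "p \<equiv> measure_pmf.prob D G"
  defines "m \<equiv> real (card B)"
  shows "integrable (measure_pmf (Pi_pmf B d (\<lambda>_. D)))
      (\<lambda>w. exp (th * (real (card {k \<in> B. w k \<in> G}) - m * p)))"
    and "measure_pmf.expectation (Pi_pmf B d (\<lambda>_. D))
      (\<lambda>w. exp (th * (real (card {k \<in> B. w k \<in> G}) - m * p))) \<le> exp (m * p * th\<^sup>2)"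
proof -
  define f where "f y = (if y \<in> G then exp th else 1)" for y
  have f_eq: "f = (\<lambda>y. 1 + (exp th - 1) * indicator G y)" by (auto simp: f_def)
  have int_f: "integrable (measure_pmf D) f"
    by (rule measure_pmf.integrable_const_bound[of _ "max 1 (exp th)"]) (auto simp: f_def)
  have int_ind: "integrable (measure_pmf D) (indicator G :: 'a \<Rightarrow> real)"
    by (rule measure_pmf.integrable_const_bound[of _ 1]) auto
  have prod_eq: "exp (th * (real (card {k \<in> B. w k \<in> G}) - m * p)) =
      exp (- (th * m * p)) * (\<Prod>k\<in>B. f (w k))" for w
  proof -
    have "(\<Prod>k\<in>B. f (w k)) = exp th ^ card {k \<in> B. w k \<in> G}"
      using B unfolding f_def by (simp add: prod.If_cases Int_def)
    then show ?thesis
      by (simp add: exp_of_nat_mult[symmetric] exp_add[symmetric] algebra_simps)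
  qed
  show "integrable (measure_pmf (Pi_pmf B d (\<lambda>_. D)))
      (\<lambda>w. exp (th * (real (card {k \<in> B. w k \<in> G}) - m * p)))"
    unfolding prod_eq using B int_f
    by (intro integrable_mult_right integrable_prod_Pi_pmf) auto
  have Ef: "measure_pmf.expectation D f \<le> exp (p * (th + th\<^sup>2))"
  proof -
    have "measure_pmf.expectation D f = 1 + (exp th - 1) * p"
      unfolding f_eq p_def using int_ind by (simp add: Bochner_Integration.integral_add)
    also have "\<dots> \<le> 1 + (th + th\<^sup>2) * p"
      using exp_le_quadratic[OF th] unfolding p_def by (intro add_left_mono mult_right_mono) auto
    also have "\<dots> \<le> exp (p * (th + th\<^sup>2))" by (metis exp_ge_add_one_self mult.commute)
    finally show ?thesis .
  qed
  have Ef0: "0 \<le> measure_pmf.expectation D f"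
    by (intro Bochner_Integration.integral_nonneg) (simp add: f_def)
  have "measure_pmf.expectation (Pi_pmf B d (\<lambda>_. D))
      (\<lambda>w. exp (th * (real (card {k \<in> B. w k \<in> G}) - m * p))) =
      exp (- (th * m * p)) * (\<Prod>k\<in>B. measure_pmf.expectation D f)"
    unfolding prod_eq using B int_f
    by (subst expectation_prod_Pi_pmf[symmetric]) (auto simp: f_def)
  also have "\<dots> = exp (- (th * m * p)) * (measure_pmf.expectation D f) ^ card B" by simp
  also have "\<dots> \<le> exp (- (th * m * p)) * exp (p * (th + th\<^sup>2)) ^ card B"
    using Ef Ef0 by (intro mult_left_mono power_mono) auto
  also have "\<dots> = exp (m * p * th\<^sup>2)"
    unfolding m_def by (simp add: exp_of_nat_mult[symmetric] exp_add[symmetric] algebra_simps)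
  finally show "measure_pmf.expectation (Pi_pmf B d (\<lambda>_. D))
      (\<lambda>w. exp (th * (real (card {k \<in> B. w k \<in> G}) - m * p))) \<le> exp (m * p * th\<^sup>2)" .
qed

lemma hits_deviation_one_sided:
  fixes D :: "'a pmf" and G :: "'a set"
  assumes B: "finite B" and th: "\<bar>th\<bar> \<le> 1"
  defines "p \<equiv> measure_pmf.prob D G"
  defines "m \<equiv> real (card B)"
  assumes x: "m * p * th\<^sup>2 \<le> x"
  shows "measure_pmf.prob (Pi_pmf B d (\<lambda>_. D))
    {w. 2 * x < th * (real (card {k \<in> B. w k \<in> G}) - m * p)} \<le> exp (- x)"
proof -
  let ?P = "Pi_pmf B d (\<lambda>_. D)"
  define Y where "Y w = exp (th * (real (card {k \<in> B. w k \<in> G}) - m * p))" for w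
  note Y = hits_mgf_le[OF B th, of d D G, folded p_def m_def, folded Y_def]
  have "measure_pmf.prob ?P {w. 2 * x < th * (real (card {k \<in> B. w k \<in> G}) - m * p)}
      = measure_pmf.expectation ?P (indicator {w. 2 * x < th * (real (card {k \<in> B. w k \<in> G}) - m * p)})"
    by simp
  also have "\<dots> \<le> measure_pmf.expectation ?P (\<lambda>w. exp (- (2 * x)) * Y w)"
  proof (rule integral_mono)
    show "integrable ?P (indicator {w. 2 * x < th * (real (card {k \<in> B. w k \<in> G}) - m * p)} :: _ \<Rightarrow> real)"
      by (rule measure_pmf.integrable_const_bound[of _ 1]) auto
    show "integrable ?P (\<lambda>w. exp (- (2 * x)) * Y w)" using Y(1) by simp
    fix w
    show "indicator {w. 2 * x < th * (real (card {k \<in> B. w k \<in> G}) - m * p)} w \<le> exp (- (2 * x)) * Y w"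
      by (auto simp: indicator_def Y_def exp_add[symmetric])
  qed
  also have "\<dots> = exp (- (2 * x)) * measure_pmf.expectation ?P Y" by simp
  also have "\<dots> \<le> exp (- (2 * x)) * exp x"
    using Y(2) x by (intro mult_left_mono) (auto intro: order.trans)
  also have "\<dots> = exp (- x)" by (simp add: exp_add[symmetric])
  finally show ?thesis .
qed

lemma hits_deviation:
  fixes D :: "'a pmf" and G :: "'a set"
  assumes B: "finite B" and x: "0 < x"
  defines "\<mu> \<equiv> real (card B) * measure_pmf.prob D G"
  shows "measure_pmf.prob (Pi_pmf B d (\<lambda>_. D))
    {w. 2 * sqrt (max \<mu> x * x) < \<bar>real (card {k \<in> B. w k \<in> G}) - \<mu>\<bar>} \<le> 2 * exp (- x)"
proof -
  let ?P = "Pi_pmf B d (\<lambda>_. D)"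
  define V where "V = max \<mu> x"
  have V: "\<mu> \<le> V" "x \<le> V" "0 < V" using x unfolding V_def by auto
  define th where "th = sqrt (x / V)"
  have th: "0 < th" "th \<le> 1" "th\<^sup>2 = x / V" using V x unfolding th_def by auto
  have "\<mu> * th\<^sup>2 \<le> V * (x / V)" unfolding th(3) using V x by (intro mult_right_mono) auto
  then have le: "real (card B) * measure_pmf.prob D G * th\<^sup>2 \<le> x" using V unfolding \<mu>_def by simp
  have eq: "th * (2 * sqrt (V * x)) = 2 * x"
  proof -
    have "sqrt (x / V) * sqrt (V * x) = sqrt (x\<^sup>2)"
      using V by (simp add: real_sqrt_mult[symmetric] power2_eq_square)
    then show ?thesis using x unfolding th_def by simp
  qed
  let ?X = "\<lambda>w. real (card {k \<in> B. w k \<in> G}) - \<mu>"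
  have "{w. 2 * sqrt (V * x) < \<bar>?X w\<bar>} \<subseteq> {w. 2 * x < th * ?X w} \<union> {w. 2 * x < - th * ?X w}"
  proof clarify
    fix w assume "2 * sqrt (V * x) < \<bar>?X w\<bar>" "\<not> 2 * x < - th * ?X w"
    then have "2 * x < th * \<bar>?X w\<bar>" using th(1) eq by (metis mult_strict_left_mono)
    then show "2 * x < th * ?X w" using \<open>\<not> 2 * x < - th * ?X w\<close> by (auto simp: abs_if split: if_splits)
  qed
  then have "measure_pmf.prob ?P {w. 2 * sqrt (V * x) < \<bar>?X w\<bar>}
      \<le> measure_pmf.prob ?P ({w. 2 * x < th * ?X w} \<union> {w. 2 * x < - th * ?X w})"
    by (intro measure_pmf.finite_measure_mono) auto
  also have "\<dots> \<le> measure_pmf.prob ?P {w. 2 * x < th * ?X w} + measure_pmf.prob ?P {w. 2 * x < - th * ?X w}"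
    by (rule measure_Un_le) auto
  also have "\<dots> \<le> exp (- x) + exp (- x)"
    using hits_deviation_one_sided[OF B, of th D G x d] hits_deviation_one_sided[OF B, of "- th" D G x d]
      th le unfolding \<mu>_def by (intro add_mono) auto
  finally show ?thesis unfolding V_def by simp
qed

lemma prob_Pi_pmf_conditional_le:
  assumes I: "finite I" and B: "B \<subseteq> I"
    and le: "\<And>f. measure_pmf.prob (Pi_pmf B d p) {g. (\<lambda>k. if k \<in> I - B then f k else g k) \<in> E} \<le> e"
  shows "measure_pmf.prob (Pi_pmf I d p) E \<le> e"
proof -
  have fin: "finite B" "finite (I - B)" using I B finite_subset by auto
  define mrg where "mrg f g k = (if k \<in> I - B then f k else g k)"
    for f g :: "'a \<Rightarrow> 'b" and k
  have "0 \<le> e" using le[of "\<lambda>_. d"] measure_nonneg order.trans by blast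
  have "Pi_pmf I d p = Pi_pmf ((I - B) \<union> B) d p" using B by (simp add: Un_absorb2)
  also have "\<dots> = map_pmf (\<lambda>(f, g) k. if k \<in> I - B then f k else g k)
      (pair_pmf (Pi_pmf (I - B) d p) (Pi_pmf B d p))"
    using fin by (intro Pi_pmf_union) auto
  also have "\<dots> = bind_pmf (Pi_pmf (I - B) d p) (\<lambda>f. map_pmf (mrg f) (Pi_pmf B d p))"
    unfolding pair_pmf_def map_pmf_def mrg_def
    by (simp add: bind_assoc_pmf bind_return_pmf)
  finally have eq: "Pi_pmf I d p = bind_pmf (Pi_pmf (I - B) d p) (\<lambda>f. map_pmf (mrg f) (Pi_pmf B d p))" .
  have "ennreal (measure_pmf.prob (Pi_pmf I d p) E) = emeasure (Pi_pmf I d p) E"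
    by (simp add: measure_pmf.emeasure_eq_measure)
  also have "\<dots> = (\<integral>\<^sup>+ f. emeasure (map_pmf (mrg f) (Pi_pmf B d p)) E \<partial>Pi_pmf (I - B) d p)"
    unfolding eq by simp
  also have "\<dots> \<le> (\<integral>\<^sup>+ f. ennreal e \<partial>Pi_pmf (I - B) d p)"
  proof (intro nn_integral_mono)
    fix f
    have "mrg f -` E = {g. (\<lambda>k. if k \<in> I - B then f k else g k) \<in> E}"
      unfolding mrg_def by auto
    then show "emeasure (map_pmf (mrg f) (Pi_pmf B d p)) E \<le> ennreal e"
      using le[of f] by (simp add: measure_pmf.emeasure_eq_measure ennreal_leI)
  qed
  also have "\<dots> = ennreal e" by simp
  finally show ?thesis using \<open>0 \<le> e\<close> by simp
qed

lemma hits_deviation_adapted: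
  fixes D :: "'a pmf" and G :: "('i \<Rightarrow> 'a) \<Rightarrow> 'a set"
  assumes I: "finite I" and B: "B \<subseteq> I" and x: "0 < x"
    and G: "\<And>w w'. (\<And>k. k \<in> I - B \<Longrightarrow> w k = w' k) \<Longrightarrow> G w = G w'"
  shows "measure_pmf.prob (Pi_pmf I d (\<lambda>_. D))
    {w. 2 * sqrt (max (real (card B) * measure_pmf.prob D (G w)) x * x)
      < \<bar>real (card {k \<in> B. w k \<in> G w}) - real (card B) * measure_pmf.prob D (G w)\<bar>}
    \<le> 2 * exp (- x)"
proof (rule prob_Pi_pmf_conditional_le[OF I B])
  fix f :: "'i \<Rightarrow> 'a"
  define mrg where "mrg g = (\<lambda>k. if k \<in> I - B then f k else g k)" for g
  define G0 where "G0 = G f"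
  have G0: "G (mrg g) = G0" for g unfolding G0_def by (intro G) (simp add: mrg_def)
  have card: "{k \<in> B. mrg g k \<in> S} = {k \<in> B. g k \<in> S}" for g S unfolding mrg_def by auto
  have "finite B" using I B finite_subset by auto
  from hits_deviation[OF this x, of d D G0]
  show "measure_pmf.prob (Pi_pmf B d (\<lambda>_. D)) {g. (\<lambda>k. if k \<in> I - B then f k else g k) \<in>
      {w. 2 * sqrt (max (real (card B) * measure_pmf.prob D (G w)) x * x)
      < \<bar>real (card {k \<in> B. w k \<in> G w}) - real (card B) * measure_pmf.prob D (G w)\<bar>}}
    \<le> 2 * exp (- x)"
    unfolding mrg_def[symmetric] by (simp add: G0 card)
qed

section \<open>The comparison model\<close>

lemma card_increasing_pairs: "card {(i, j) \<in> {1..n} \<times> {1..n}. i < j} = n choose 2"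
proof (induction n)
  case (Suc n)
  have "{(i, j) \<in> {1..Suc n} \<times> {1..Suc n}. i < j} =
      {(i, j) \<in> {1..n} \<times> {1..n}. i < j} \<union> (\<lambda>i. (i, Suc n)) ` {1..n}"
    by (auto simp: le_Suc_eq)
  also have "card \<dots> = (n choose 2) + n"
    using Suc.IH by (subst card_Un_disjoint) (auto intro: finite_subset[of _ "{1..n} \<times> {1..n}"]
      simp: card_image inj_on_def)
  also have "\<dots> = Suc n choose 2" by (simp add: numeral_2_eq_2)
  finally show ?case .
qed simp

lemma real_choose_two: "real (n choose 2) = real n * (real n - 1) / 2"
proof -
  have "even (n * (n - 1))" by (cases n) auto
  then show ?thesis
    by (cases n) (auto simp: choose_two real_of_nat_div algebra_simps)
qed

lemma noisy_matrix_bounds: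
  assumes "0 \<le> lam" "lam \<le> 1/2"
  shows "0 \<le> noisy_matrix lam i j" "noisy_matrix lam i j \<le> 1"
  using assms unfolding noisy_matrix_def by auto

lemma pmf_comparison_pmf:
  assumes \<pi>: "\<pi> permutes {1..n}" and lam: "0 \<le> lam" "lam \<le> 1/2"
    and n: "2 \<le> n" and a: "a \<in> {1..n}" and b: "b \<in> {1..n}"
  shows "pmf (comparison_pmf n lam \<pi>) (a, b) =
    (if a = b then 0 else noisy_matrix lam (\<pi> a) (\<pi> b) / real (n choose 2))"
proof -
  define S where "S = {(i, j) \<in> {1..n} \<times> {1..n}. i < j}"
  have S: "finite S" "S \<noteq> {}" "card S = n choose 2"
  proof -
    show "finite S" unfolding S_def by (rule finite_subset[of _ "{1..n} \<times> {1..n}"]) auto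
    have "(1, 2) \<in> S" using n unfolding S_def by auto
    then show "S \<noteq> {}" by blast
    show "card S = n choose 2" unfolding S_def by (rule card_increasing_pairs)
  qed
  note M = noisy_matrix_bounds[OF lam]
  define f where "f = (\<lambda>(i, j). map_pmf (\<lambda>b. if b then (i, j) else (j, i))
                   (bernoulli_pmf (noisy_matrix lam (\<pi> i) (\<pi> j))))"
  have f: "pmf (f (i, j)) (a, b) = (if (i, j) = (a, b) then noisy_matrix lam (\<pi> i) (\<pi> j) else
      if (i, j) = (b, a) then 1 - noisy_matrix lam (\<pi> i) (\<pi> j) else 0)" if "i < j" for i j
  proof -
    have "(\<lambda>b. if b then (i, j) else (j, i)) -` {(a, b)} =
        (if (i, j) = (a, b) then {True} else if (i, j) = (b, a) then {False} else {})"
      using that by (auto split: if_splits)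
    then show ?thesis
      unfolding f_def using M by (simp add: pmf_map measure_pmf_single)
  qed
  have "pmf (comparison_pmf n lam \<pi>) (a, b) = (\<Sum>x\<in>S. pmf (f x) (a, b)) / real (n choose 2)"
    unfolding comparison_pmf_def S_def[symmetric] f_def[symmetric] pmf_bind S(3)[symmetric]
    using S by (subst integral_pmf_of_set) auto
  also have "(\<Sum>x\<in>S. pmf (f x) (a, b)) = (if a = b then 0 else noisy_matrix lam (\<pi> a) (\<pi> b))"
  proof -
    have "(\<Sum>x\<in>S. pmf (f x) (a, b)) = (\<Sum>x\<in>S. (if x = (a, b) then noisy_matrix lam (\<pi> a) (\<pi> b) else 0) +
        (if x = (b, a) then 1 - noisy_matrix lam (\<pi> b) (\<pi> a) else 0))"
    proof (intro sum.cong refl)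
      fix x assume x: "x \<in> S"
      obtain i j where [simp]: "x = (i, j)" by (cases x)
      have "i < j" using x unfolding S_def by simp
      then show "pmf (f x) (a, b) = (if x = (a, b) then noisy_matrix lam (\<pi> a) (\<pi> b) else 0) +
        (if x = (b, a) then 1 - noisy_matrix lam (\<pi> b) (\<pi> a) else 0)"
        using f[of i j] by auto
    qed
    also have "\<dots> = (if (a, b) \<in> S then noisy_matrix lam (\<pi> a) (\<pi> b) else 0) +
        (if (b, a) \<in> S then 1 - noisy_matrix lam (\<pi> b) (\<pi> a) else 0)"
      using S(1) by (simp add: sum.distrib)
    also have "\<dots> = (if a = b then 0 else noisy_matrix lam (\<pi> a) (\<pi> b))"
    proof -
      have "\<pi> a \<noteq> \<pi> b" if "a \<noteq> b" using permutes_inj[OF \<pi>] that by (auto dest: injD)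
      then show ?thesis using a b unfolding S_def noisy_matrix_def by auto
    qed
    finally show ?thesis .
  qed
  finally show ?thesis by simp
qed

lemma prob_comparison_pmf:
  assumes \<pi>: "\<pi> permutes {1..n}" and lam: "0 \<le> lam" "lam \<le> 1/2" and n: "2 \<le> n"
    and G: "G \<subseteq> {1..n} \<times> {1..n}"
  shows "measure_pmf.prob (comparison_pmf n lam \<pi>) G =
    (\<Sum>(a, b)\<in>{(a, b) \<in> G. a \<noteq> b}. noisy_matrix lam (\<pi> a) (\<pi> b)) / real (n choose 2)"
proof -
  have fin: "finite G" using G finite_subset by blast
  have "measure_pmf.prob (comparison_pmf n lam \<pi>) G = (\<Sum>x\<in>G. pmf (comparison_pmf n lam \<pi>) x)"
    by (rule measure_measure_pmf_finite[OF fin])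
  also have "\<dots> = (\<Sum>(a, b)\<in>G. if a \<noteq> b then noisy_matrix lam (\<pi> a) (\<pi> b) / real (n choose 2) else 0)"
  proof (intro sum.cong refl, clarify)
    fix a b assume "(a, b) \<in> G"
    then show "pmf (comparison_pmf n lam \<pi>) (a, b) =
        (if a \<noteq> b then noisy_matrix lam (\<pi> a) (\<pi> b) / real (n choose 2) else 0)"
      using pmf_comparison_pmf[OF \<pi> lam n, of a b] G by auto
  qed
  also have "\<dots> = (\<Sum>(a, b)\<in>{(a, b) \<in> G. a \<noteq> b}. noisy_matrix lam (\<pi> a) (\<pi> b) / real (n choose 2))"
    using fin by (intro sum.mono_neutral_cong_right) (auto split: if_splits)
  finally show ?thesis by (simp add: sum_divide_distrib case_prod_unfold)
qed

lemma sum_wins: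
  assumes "finite G" "finite B"
  shows "(\<Sum>(a, b)\<in>G. real (wins w B a b)) = real (card {k \<in> B. w k \<in> G})"
proof -
  have "(\<Sum>(a, b)\<in>G. real (wins w B a b)) = (\<Sum>x\<in>G. \<Sum>k\<in>B. if x = w k then 1 else 0)"
  proof (intro sum.cong refl)
    fix x assume "x \<in> G"
    have "{k \<in> B. w k = x} = B \<inter> {k. x = w k}" by auto
    then show "(case x of (a, b) \<Rightarrow> real (wins w B a b)) = (\<Sum>k\<in>B. if x = w k then 1 else 0)"
      using assms(2) by (cases x) (simp add: wins_def sum.If_cases)
  qed
  also have "\<dots> = (\<Sum>k\<in>B. \<Sum>x\<in>G. if x = w k then 1 else 0)" by (rule sum.swap)
  also have "\<dots> = (\<Sum>k\<in>B. if w k \<in> G then 1 else 0)" using assms(1) by simp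
  also have "\<dots> = real (card {k \<in> B. w k \<in> G})" using assms(2) by (simp add: sum.If_cases Int_def)
  finally show ?thesis .
qed

lemma sum_wins_row:
  assumes "finite I" "finite B"
  shows "(\<Sum>j\<in>I. real (wins w B i j)) = real (card {k \<in> B. w k \<in> {i} \<times> I})"
proof -
  have "(\<Sum>j\<in>I. real (wins w B i j)) = (\<Sum>(a, b)\<in>{i} \<times> I. real (wins w B a b))"
    by (simp add: sum.cartesian_product[symmetric])
  then show ?thesis using sum_wins[of "{i} \<times> I" B w] assms by simp
qed

lemma prob_comparison_row:
  assumes \<pi>: "\<pi> permutes {1..n}" and lam: "0 \<le> lam" "lam \<le> 1/2" and n: "2 \<le> n"
    and I: "I \<subseteq> {1..n}" and i: "i \<in> {1..n}"
  shows "measure_pmf.prob (comparison_pmf n lam \<pi>) ({i} \<times> I) =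
    (\<Sum>j\<in>I - {i}. noisy_matrix lam (\<pi> i) (\<pi> j)) / real (n choose 2)"
proof -
  have "{(a, b) \<in> {i} \<times> I. a \<noteq> b} = {i} \<times> (I - {i})" by auto
  moreover have "{i} \<times> I \<subseteq> {1..n} \<times> {1..n}" using i I by auto
  ultimately show ?thesis
    using prob_comparison_pmf[OF \<pi> lam n, of "{i} \<times> I"]
    by (simp add: sum.cartesian_product[symmetric])
qed

lemma sum_noisy_matrix_row:
  assumes \<pi>: "\<pi> permutes {1..n}" and i: "i \<in> {1..n}"
  shows "(\<Sum>j\<in>{1..n} - {i}. noisy_matrix lam (\<pi> i) (\<pi> j)) =
    (real n - 1) / 2 + lam * (2 * real (\<pi> i) - real n - 1)"
proof -
  note r = permutes_range[OF \<pi> i]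
  have inj: "inj \<pi>" using permutes_inj[OF \<pi>] .
  have "(\<Sum>j\<in>{1..n} - {i}. noisy_matrix lam (\<pi> i) (\<pi> j)) =
      (\<Sum>r\<in>\<pi> ` ({1..n} - {i}). noisy_matrix lam (\<pi> i) r)"
    using inj by (simp add: sum.reindex inj_on_subset[OF inj] o_def)
  also have "\<pi> ` ({1..n} - {i}) = {1..<\<pi> i} \<union> {\<pi> i<..n}"
  proof -
    have "\<pi> ` ({1..n} - {i}) = {1..n} - {\<pi> i}"
      unfolding image_set_diff[OF inj] permutes_image[OF \<pi>] by simp
    then show ?thesis using r by auto
  qed
  also have "(\<Sum>r\<in>\<dots>. noisy_matrix lam (\<pi> i) r) =
      (\<Sum>r\<in>{1..<\<pi> i}. 1/2 + lam) + (\<Sum>r\<in>{\<pi> i<..n}. 1/2 - lam)"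
    by (subst sum.union_disjoint) (auto simp: noisy_matrix_def)
  also have "\<dots> = (real (\<pi> i) - 1) * (1/2 + lam) + (real n - real (\<pi> i)) * (1/2 - lam)"
    using r by (simp add: of_nat_diff)
  finally show ?thesis by (simp add: field_simps)
qed

lemma sum_truncated: "2 * (\<Sum>r\<in>{1..n}. r - h - 1) = (n - h - 1) * (n - h)" for n h :: nat
proof (induction n)
  case (Suc n)
  have "2 * (\<Sum>r\<in>{1..Suc n}. r - h - 1) = 2 * (n - h) + (n - h - 1) * (n - h)"
    using Suc.IH by simp
  also have "\<dots> = (Suc n - h - 1) * (Suc n - h)"
  proof (cases "h < n")
    case True
    then obtain k where "n = h + Suc k" using less_imp_add_positive[of h n] by (metis Suc_pred)
    then show ?thesis by simp
  qed (cases "h = n"; simp)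
  finally show ?case .
qed simp

lemma card_far_pairs:
  assumes \<sigma>: "\<sigma> permutes {1..n}" and n: "16 \<le> n"
  defines "P \<equiv> {(i, j) \<in> {1..n} \<times> {1..n}. real (\<sigma> i) - real (\<sigma> j) > real n / 2}"
  shows "real n * (real n - 2) / 8 \<le> real (card P)"
    and "real (card P) \<le> real n * (real n - 2) / 8 + 3 * (real n - 2) / 8"
proof -
  define h where "h = n div 2"
  have inj: "inj \<sigma>" using permutes_inj[OF \<sigma>] .
  have far: "real r - real s > real n / 2 \<longleftrightarrow> s < r - h" for r s :: nat
  proof -
    have "real r - real s > real n / 2 \<longleftrightarrow> 2 * r > n + 2 * s" by linarith
    also have "\<dots> \<longleftrightarrow> s < r - h" unfolding h_def by presburger
    finally show ?thesis .
  qed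
  have "map_prod \<sigma> \<sigma> ` P = (SIGMA r:{1..n}. {1..<r - h})" (is "?L = ?R")
  proof
    show "?L \<subseteq> ?R"
    proof (intro image_subsetI, clarify)
      fix i j assume "(i, j) \<in> P"
      then have ij: "i \<in> {1..n}" "j \<in> {1..n}" "\<sigma> j < \<sigma> i - h" unfolding P_def using far by auto
      then show "map_prod \<sigma> \<sigma> (i, j) \<in> ?R"
        using permutes_range[OF \<sigma> ij(1)] permutes_range[OF \<sigma> ij(2)] by simp
    qed
    show "?R \<subseteq> ?L"
    proof clarify
      fix r s assume rs: "r \<in> {1..n}" "s \<in> {1..<r - h}"
      then have "r \<in> \<sigma> ` {1..n}" "s \<in> \<sigma> ` {1..n}" unfolding permutes_image[OF \<sigma>] by auto
      then obtain i j where ij: "i \<in> {1..n}" "r = \<sigma> i" "j \<in> {1..n}" "s = \<sigma> j" by blast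
      then have "real (\<sigma> i) - real (\<sigma> j) > real n / 2" using rs by (simp only: far) simp
      then have "(i, j) \<in> P" using ij unfolding P_def by simp
      then show "(r, s) \<in> ?L" using ij by force
    qed
  qed
  then have "card P = card (SIGMA r:{1..n}. {1..<r - h})"
    using card_image[of "map_prod \<sigma> \<sigma>" P] map_prod_inj_on[OF inj_on_subset[OF inj] inj_on_subset[OF inj]]
    by (metis inj_on_subset map_prod_inj_on inj UNIV_Times_UNIV subset_UNIV)
  also have "\<dots> = (\<Sum>r\<in>{1..n}. r - h - 1)" by simp
  finally have cP: "2 * card P = (n - h - 1) * (n - h)" using sum_truncated[where n = n and h = h] by simp
  have "real (n - h - 1) = real n - real h - 1" "real (n - h) = real n - real h"
    using n unfolding h_def by auto
  then have cP': "real (card P) = (real n - real h - 1) * (real n - real h) / 2"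
    using arg_cong[OF cP, of real] by simp
  consider "n = 2 * h" | "n = 2 * h + 1" unfolding h_def by linarith
  then have "real n * (real n - 2) / 8 \<le> real (card P) \<and>
      real (card P) \<le> real n * (real n - 2) / 8 + 3 * (real n - 2) / 8"
  proof cases
    case 1
    then have "real n = 2 * real h" by simp
    then show ?thesis using n unfolding cP' by (simp add: field_simps)
  next
    case 2
    then have "real n = 2 * real h + 1" "2 \<le> real h" using n by auto
    then show ?thesis unfolding cP' by (simp add: field_simps)
  qed
  then show "real n * (real n - 2) / 8 \<le> real (card P)"
    and "real (card P) \<le> real n * (real n - 2) / 8 + 3 * (real n - 2) / 8" by blast+
qed

section \<open>Typical samples\<close>

definition hits_typical :: "'a pmf \<Rightarrow> real \<Rightarrow> 'i set \<Rightarrow> 'a set \<Rightarrow> ('i \<Rightarrow> 'a) \<Rightarrow> bool" where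
  "hits_typical D x B G w \<longleftrightarrow>
    \<bar>real (card {k \<in> B. w k \<in> G}) - real (card B) * measure_pmf.prob D G\<bar>
      \<le> 2 * sqrt (max (real (card B) * measure_pmf.prob D G) x * x)"

lemma hits_typical_scaled:
  assumes typical: "hits_typical D x B G w" and s: "0 \<le> s" and x: "0 \<le> x"
    and \<mu>: "s * (real (card B) * measure_pmf.prob D G) \<le> V" and xV: "s * x \<le> V" and y: "s * x \<le> y"
  shows "\<bar>s * real (card {k \<in> B. w k \<in> G}) - s * (real (card B) * measure_pmf.prob D G)\<bar>
    \<le> 2 * sqrt (V * y)"
proof -
  define \<mu> where "\<mu> = real (card B) * measure_pmf.prob D G"
  define X where "X = real (card {k \<in> B. w k \<in> G})"
  have V: "0 \<le> V" using order.trans[OF mult_nonneg_nonneg[OF s x] xV] .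
  have "\<bar>s * X - s * \<mu>\<bar> = s * \<bar>X - \<mu>\<bar>" using s by (simp add: abs_mult right_diff_distrib[symmetric])
  also have "\<dots> \<le> s * (2 * sqrt (max \<mu> x * x))"
    using typical s unfolding hits_typical_def \<mu>_def X_def by (intro mult_left_mono) auto
  also have "\<dots> = 2 * sqrt (s\<^sup>2 * (max \<mu> x * x))"
    using s by (simp only: real_sqrt_mult[of "s\<^sup>2"] real_sqrt_abs abs_of_nonneg)
  also have "s\<^sup>2 * (max \<mu> x * x) = (s * max \<mu> x) * (s * x)" by (simp add: power2_eq_square)
  also have "s * max \<mu> x \<le> V" using \<mu> xV unfolding \<mu>_def by (simp add: max_def)
  then have "2 * sqrt ((s * max \<mu> x) * (s * x)) \<le> 2 * sqrt (V * y)"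
    using s x y V by (intro mult_left_mono real_sqrt_le_mono mult_mono) auto
  finally show ?thesis unfolding \<mu>_def X_def .
qed

lemma ms_sets_subset: "fst (ms_sets C0 C1 n N T lh A t i) \<subseteq> {1..n}"
proof (induction t)
  case (Suc t)
  then show ?case by (auto simp: ms_update_def Let_def split: prod.splits)
qed simp

lemma ms_noise_okI:
  assumes \<pi>: "\<pi> permutes {1..n}" and lam: "0 \<le> lam" "lam \<le> 1/2" and n: "2 \<le> n"
    and N: "0 < N" and T: "T dvd N" and x: "0 \<le> x" "x \<le> 10 * log 2 (real n * real T)"
    and sub: "\<And>i. fst (P i) \<subseteq> {1..n}"
    and typical: "\<And>i. i \<in> {1..n} \<Longrightarrow> hits_typical (comparison_pmf n lam \<pi>) x
      {N + t * (N div T)..<N + Suc t * (N div T)} ({i} \<times> fst (P i)) w"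
  shows "ms_noise_ok n N T lam \<pi> (stage_wins N T w (Suc t)) P"
  unfolding ms_noise_ok_def
proof
  fix i assume i: "i \<in> {1..n}"
  define I where "I = fst (P i)"
  define B where "B = {N + t * (N div T)..<N + Suc t * (N div T)}"
  define \<beta> where "\<beta> = ms_beta n N T"
  define M where "M = (\<Sum>j\<in>I - {i}. noisy_matrix lam (\<pi> i) (\<pi> j))"
  define s where "s = real T * real n * (real n - 1) / (2 * real N)"
  have T0: "0 < T" using T N by (cases T) auto
  have s: "0 < s" unfolding s_def using T0 n N by simp
  have fin: "finite I" using sub[of i] finite_subset unfolding I_def by blast
  have card: "real (card B) = real N / real T" using T unfolding B_def by (simp add: real_of_nat_div)
  have sums: "(\<Sum>j\<in>I. real (stage_wins N T w (Suc t) i j)) = real (card {k \<in> B. w k \<in> {i} \<times> I})"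
    using sum_wins_row[OF fin, of B w i] unfolding stage_wins_def B_def by simp
  have "measure_pmf.prob (comparison_pmf n lam \<pi>) ({i} \<times> I) = M / (real n * (real n - 1) / 2)"
    using prob_comparison_row[OF \<pi> lam n sub[of i] i] unfolding I_def M_def real_choose_two .
  then have mean: "s * (real (card B) * measure_pmf.prob (comparison_pmf n lam \<pi>) ({i} \<times> I)) = M"
    unfolding card s_def using T0 n N by simp
  have "M \<le> (\<Sum>j\<in>I - {i}. 1)" unfolding M_def by (intro sum_mono noisy_matrix_bounds lam)
  also have "\<dots> \<le> real (card I)" using fin by (simp add: card_mono)
  finally have M: "M \<le> real (card I)" .
  have sx: "s * x \<le> 5 * \<beta>"
  proof -
    have "s * x \<le> real T * real n * real n / (2 * real N) * (10 * log 2 (real n * real T))"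
      unfolding s_def using x n by (intro mult_mono divide_right_mono mult_left_mono) auto
    also have "\<dots> = 5 * \<beta>" unfolding \<beta>_def ms_beta_def by (simp add: power2_eq_square)
    finally show ?thesis .
  qed
  have "\<bar>s * real (card {k \<in> B. w k \<in> {i} \<times> I}) -
      s * (real (card B) * measure_pmf.prob (comparison_pmf n lam \<pi>) ({i} \<times> I))\<bar>
      \<le> 2 * sqrt (5 * max (real (card I)) \<beta> * (5 * \<beta>))"
    using typical[OF i] M sx s x(1) unfolding mean[symmetric] B_def I_def
    by (intro hits_typical_scaled) auto
  also have "\<dots> = 10 * sqrt (max (real (card I)) \<beta> * \<beta>)"
  proof -
    have "5 * max (real (card I)) \<beta> * (5 * \<beta>) = 5\<^sup>2 * (max (real (card I)) \<beta> * \<beta>)" by simp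
    then show ?thesis by (simp only: real_sqrt_mult[of "5\<^sup>2"] real_sqrt_abs)
  qed
  finally show "\<bar>real T * real n * (real n - 1) / (2 * real N) *
      (\<Sum>j\<in>fst (P i). real (stage_wins N T w (Suc t) i j)) -
      (\<Sum>j\<in>fst (P i) - {i}. noisy_matrix lam (\<pi> i) (\<pi> j))\<bar>
      \<le> 10 * sqrt (max (real (card (fst (P i)))) (ms_beta n N T) * ms_beta n N T)"
    unfolding I_def[symmetric] sums mean s_def[symmetric] M_def[symmetric] \<beta>_def .
qed

definition prelim_perm :: "nat \<Rightarrow> nat \<Rightarrow> ((nat \<Rightarrow> real) \<Rightarrow> nat \<Rightarrow> nat) \<Rightarrow> (nat \<Rightarrow> nat \<times> nat) \<Rightarrow> nat \<Rightarrow> nat"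
  where "prelim_perm n N srt w = srt (\<lambda>i. \<Sum>j\<in>{1..n}. real (wins1 N w i j))"

definition far_pairs :: "nat \<Rightarrow> (nat \<Rightarrow> nat) \<Rightarrow> (nat \<times> nat) set"
  where "far_pairs n \<sigma> = {(i, j) \<in> {1..n} \<times> {1..n}. real (\<sigma> i) - real (\<sigma> j) > real n / 2}"

lemma prelim_perm_close:
  assumes \<pi>: "\<pi> permutes {1..n}" and lam: "c \<le> lam" "lam \<le> 1/2" and c: "0 < c" and n: "2 \<le> n"
    and N: "even N" "64 * real n * x \<le> c\<^sup>2 * real N" "real n * x \<le> real N" and x: "0 < x"
    and srt: "sorting_rule n srt"
    and typical: "\<And>i. i \<in> {1..n} \<Longrightarrow> hits_typical (comparison_pmf n lam \<pi>) x
      {0..<N div 2} ({i} \<times> {1..n}) w"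
    and i: "i \<in> {1..n}"
  shows "\<bar>real (prelim_perm n N srt w i) - real (\<pi> i)\<bar> \<le> real n / 4"
proof (rule approx_sorted_dist[OF \<pi> _ _ _ i])
  define S where "S i = (\<Sum>j\<in>{1..n}. real (wins1 N w i j))" for i
  have P: "prelim_perm n N srt w = srt S" unfolding prelim_perm_def S_def ..
  show "prelim_perm n N srt w permutes {1..n}" using srt unfolding P sorting_rule_def by blast
  show "0 \<le> real n / 4" by simp
  fix i j assume i: "i \<in> {1..n}" and j: "j \<in> {1..n}" and d: "real n / 4 < real (\<pi> i) - real (\<pi> j)"
  have N0: "0 < real N"
  proof -
    have "0 < 64 * real n * x" using n x by simp
    then have "c\<^sup>2 * real N \<noteq> 0" using N(2) by linarith
    then show ?thesis by simp
  qed
  define \<eta> where "\<eta> = sqrt (real N * x / real n)"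
  define f where "f i = real N / (real n * (real n - 1)) * ((real n - 1) / 2 + lam * (2 * real (\<pi> i) - real n - 1))" for i
  have S: "\<bar>S i - f i\<bar> \<le> 2 * \<eta>" if i: "i \<in> {1..n}" for i
  proof -
    have lam': "0 \<le> lam" using lam c by simp
    have card: "real (card {0..<N div 2}) = real N / 2" using N(1) by (simp add: real_of_nat_div)
    have sums: "S i = real (card {k \<in> {0..<N div 2}. w k \<in> {i} \<times> {1..n}})"
      unfolding S_def wins1_def by (rule sum_wins_row) auto
    define Z where "Z = (real n - 1) / 2 + lam * (2 * real (\<pi> i) - real n - 1)"
    have prob: "measure_pmf.prob (comparison_pmf n lam \<pi>) ({i} \<times> {1..n}) = Z / (real n * (real n - 1) / 2)"
      using prob_comparison_row[OF \<pi> lam' lam(2) n subset_refl i]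
      unfolding sum_noisy_matrix_row[OF \<pi> i] real_choose_two Z_def .
    have mean: "real (card {0..<N div 2}) * measure_pmf.prob (comparison_pmf n lam \<pi>) ({i} \<times> {1..n}) = f i"
      unfolding card prob f_def Z_def[symmetric] by simp
    have "f i \<le> real N / real n"
    proof -
      have "(\<Sum>j\<in>{1..n} - {i}. noisy_matrix lam (\<pi> i) (\<pi> j)) \<le> (\<Sum>j\<in>{1..n} - {i}. 1)"
        by (intro sum_mono noisy_matrix_bounds lam lam')
      also have "\<dots> = real n - 1" using i by (simp add: of_nat_diff)
      finally have "f i \<le> real N / (real n * (real n - 1)) * (real n - 1)"
        unfolding sum_noisy_matrix_row[OF \<pi> i] f_def using n by (intro mult_left_mono) auto
      then show ?thesis using n by simp
    qed
    moreover have "x \<le> real N / real n" using N(3) n by (simp add: pos_le_divide_eq mult.commute)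
    ultimately have "\<bar>S i - f i\<bar> \<le> 2 * sqrt (real N / real n * x)"
      using hits_typical_scaled[OF typical[OF i], of 1 "real N / real n" x] x
      unfolding sums[symmetric] mean by simp
    then show ?thesis unfolding \<eta>_def by simp
  qed
  have "4 * \<eta> \<le> real N * c / (2 * real n)"
  proof -
    have "(4 * \<eta>)\<^sup>2 = 16 * (real N * x / real n)"
      using x unfolding \<eta>_def by (simp add: power_mult_distrib)
    also have "\<dots> = real N / (4 * (real n)\<^sup>2) * (64 * real n * x)"
      using n by (simp add: power2_eq_square)
    also have "\<dots> \<le> real N / (4 * (real n)\<^sup>2) * (c\<^sup>2 * real N)"
      using N(2) by (intro mult_left_mono) auto
    also have "\<dots> = (real N * c / (2 * real n))\<^sup>2" by (simp add: power2_eq_square)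
    finally show ?thesis by (rule power2_le_imp_le) (use c in simp)
  qed
  also have "\<dots> < f i - f j"
  proof -
    have "real N * c / (2 * real n) \<le> real N * c / (2 * (real n - 1))"
      using n c N0 by (intro divide_left_mono) auto
    also have "\<dots> = real N / (real n * (real n - 1)) * (2 * c * (real n / 4))"
      using n by simp
    also have "\<dots> < real N / (real n * (real n - 1)) * (2 * lam * (real (\<pi> i) - real (\<pi> j)))"
      using N0 n d c lam by (intro mult_strict_left_mono mult_le_less_imp_less) auto
    also have "\<dots> = f i - f j"
      unfolding f_def by (simp add: algebra_simps)
    finally show ?thesis .
  qed
  finally have "S j < S i" using S[OF i] S[OF j] by linarith
  then show "prelim_perm n N srt w j < prelim_perm n N srt w i"
    using srt i j unfolding P sorting_rule_def by blast
qed

lemma lam_hat_error: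
  assumes \<pi>: "\<pi> permutes {1..n}" and lam: "0 \<le> lam" "lam \<le> 1/2" and n: "16 \<le> n"
    and N: "even N" "2 * x \<le> real N" and x: "0 < x"
    and srt: "sorting_rule n srt"
    and close: "\<And>i. i \<in> {1..n} \<Longrightarrow> \<bar>real (prelim_perm n N srt w i) - real (\<pi> i)\<bar> \<le> real n / 4"
    and typical: "hits_typical (comparison_pmf n lam \<pi>) x {N div 2..<N} (far_pairs n (prelim_perm n N srt w)) w"
  shows "lam - 13 * sqrt (x / real N) \<le> lam_hat n N srt w"
    and "lam_hat n N srt w \<le> lam + 3 / real n + 13 * sqrt (x / real N)"
proof -
  define \<sigma> where "\<sigma> = prelim_perm n N srt w"
  define F where "F = far_pairs n \<sigma>"
  define R where "R = real n * (real n - 2) / 8"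
  define s where "s = 2 / real N * real (n choose 2) / R"
  define D where "D = comparison_pmf n lam \<pi>"
  have N0: "0 < real N" using N(2) x by linarith
  have n2: "2 \<le> n" using n by simp
  have R0: "0 < R" unfolding R_def using n by simp
  have \<sigma>: "\<sigma> permutes {1..n}" using srt unfolding \<sigma>_def prelim_perm_def sorting_rule_def by blast
  have sub: "F \<subseteq> {1..n} \<times> {1..n}" unfolding F_def far_pairs_def by auto
  then have fin: "finite F" using finite_subset by blast
  have lt: "\<pi> b < \<pi> a" if "(a, b) \<in> F" for a b
  proof -
    have "a \<in> {1..n}" "b \<in> {1..n}" "real (\<sigma> a) - real (\<sigma> b) > real n / 2"
      using that unfolding F_def far_pairs_def by auto
    then have "real (\<pi> a) - real (\<pi> b) > 0"
      using close[of a] close[of b] unfolding \<sigma>_def by linarith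
    then show ?thesis by linarith
  qed
  have "{(a, b) \<in> F. a \<noteq> b} = F" using lt by force
  moreover have "(\<Sum>(a, b)\<in>F. noisy_matrix lam (\<pi> a) (\<pi> b)) = (\<Sum>(a, b)\<in>F. 1/2 + lam)"
    using lt by (intro sum.cong) (auto simp: noisy_matrix_def)
  ultimately have prob: "measure_pmf.prob D F = real (card F) * (1/2 + lam) / real (n choose 2)"
    unfolding D_def prob_comparison_pmf[OF \<pi> lam n2 sub] by (simp add: case_prod_unfold)
  have card: "real (card {N div 2..<N}) = real N / 2" using N(1) by (auto simp: real_of_nat_div)
  have C0: "0 < real (n choose 2)" using n by (simp add: real_choose_two)
  define \<rho> where "\<rho> = real (card F) / R"
  have mean: "s * (real (card {N div 2..<N}) * measure_pmf.prob D F) = \<rho> * (1/2 + lam)"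
    unfolding prob card s_def \<rho>_def using N0 C0 by simp
  have hat: "lam_hat n N srt w = s * real (card {k \<in> {N div 2..<N}. w k \<in> F}) - 1/2"
  proof -
    have "1/2 * (real n / 2) * (real n / 2 - 1) = R" unfolding R_def by (simp add: field_simps)
    moreover have "(\<Sum>(i, j)\<in>F. real (wins2 N w i j)) = real (card {k \<in> {N div 2..<N}. w k \<in> F})"
      unfolding wins2_def by (rule sum_wins[OF fin]) simp
    ultimately show ?thesis
      unfolding lam_hat_def prelim_perm_def[symmetric] Let_def \<sigma>_def[symmetric] far_pairs_def[symmetric]
        F_def[symmetric] s_def by (simp only: divide_inverse)
  qed
  have \<rho>: "1 \<le> \<rho>" "\<rho> \<le> 1 + 3 / real n"
  proof -
    note c = card_far_pairs[OF \<sigma> n, folded far_pairs_def, folded F_def R_def]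
    show "1 \<le> \<rho>" using c(1) R0 unfolding \<rho>_def by simp
    have "R + 3 * (real n - 2) / 8 = (1 + 3 / real n) * R"
      unfolding R_def using n by (simp add: field_simps)
    then show "\<rho> \<le> 1 + 3 / real n" using c(2) R0 unfolding \<rho>_def by (simp add: pos_divide_le_eq)
  qed
  have s: "0 \<le> s" "s \<le> 9 / real N"
  proof -
    show "0 \<le> s" unfolding s_def using R0 by simp
    have "real (n choose 2) / R = 4 * (real n - 1) / (real n - 2)"
      unfolding R_def real_choose_two using n by (simp add: field_simps)
    also have "\<dots> \<le> 9 / 2" using n by (simp add: pos_divide_le_eq)
    finally have "2 / real N * (real (n choose 2) / R) \<le> 2 / real N * (9 / 2)"
      by (intro mult_left_mono) auto
    then show "s \<le> 9 / real N" unfolding s_def by simp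
  qed
  have "\<bar>1 * real (card {k \<in> {N div 2..<N}. w k \<in> F}) - 1 * (real (card {N div 2..<N}) * measure_pmf.prob D F)\<bar>
      \<le> 2 * sqrt (real N / 2 * x)"
  proof (rule hits_typical_scaled)
    show "hits_typical D x {N div 2..<N} F w" using typical unfolding D_def F_def \<sigma>_def .
    have "real (card {N div 2..<N}) * measure_pmf.prob D F \<le> real (card {N div 2..<N}) * 1"
      by (intro mult_left_mono) auto
    then show "1 * (real (card {N div 2..<N}) * measure_pmf.prob D F) \<le> real N / 2" using card by simp
  qed (use N x in auto)
  then have "s * \<bar>real (card {k \<in> {N div 2..<N}. w k \<in> F}) - real (card {N div 2..<N}) * measure_pmf.prob D F\<bar>
      \<le> 9 / real N * (2 * sqrt (real N / 2 * x))"
    using s N0 x by (intro mult_mono) auto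
  also have "\<dots> \<le> 13 * sqrt (x / real N)"
  proof (rule power2_le_imp_le)
    have "(9 / real N * (2 * sqrt (real N / 2 * x)))\<^sup>2 = 162 * (x / real N)"
      using N0 x by (simp add: power_mult_distrib power_divide power2_eq_square[of "real N"])
    also have "\<dots> \<le> 169 * (x / real N)" using N0 x by (intro mult_right_mono) auto
    also have "\<dots> = (13 * sqrt (x / real N))\<^sup>2" using N0 x by (simp add: power_mult_distrib)
    finally show "(9 / real N * (2 * sqrt (real N / 2 * x)))\<^sup>2 \<le> (13 * sqrt (x / real N))\<^sup>2" .
  qed (use N0 x in auto)
  finally have "\<bar>lam_hat n N srt w + 1/2 - \<rho> * (1/2 + lam)\<bar> \<le> 13 * sqrt (x / real N)"
    unfolding hat mean[symmetric] using s(1) by (simp add: abs_mult right_diff_distrib[symmetric])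
  moreover define m where "m = \<rho> * (1/2 + lam)"
  moreover define e where "e = 13 * sqrt (x / real N)"
  ultimately have dev: "lam_hat n N srt w + 1/2 - m \<le> e" "m - (lam_hat n N srt w + 1/2) \<le> e"
    by (simp_all add: abs_le_iff)
  have "1 * (1/2 + lam) \<le> m" unfolding m_def using \<rho> lam by (intro mult_right_mono) auto
  then have "1/2 + lam \<le> m" by simp
  then show "lam - 13 * sqrt (x / real N) \<le> lam_hat n N srt w"
    using dev(2) unfolding e_def[symmetric] by linarith
  have "m \<le> (1 + 3 / real n) * (1/2 + lam)" unfolding m_def using \<rho> lam by (intro mult_right_mono) auto
  also have "\<dots> = 1/2 + lam + 3 / real n * (1/2 + lam)" by (simp add: algebra_simps)
  also have "\<dots> \<le> 1/2 + lam + 3 / real n * 1" using lam by (intro add_left_mono mult_left_mono) auto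
  finally show "lam_hat n N srt w \<le> lam + 3 / real n + 13 * sqrt (x / real N)"
    using dev(1) unfolding e_def[symmetric] by linarith
qed

lemma wins_cong: "(\<And>k. k \<in> B \<Longrightarrow> w k = w' k) \<Longrightarrow> wins w B = wins w' B"
  unfolding wins_def by (intro ext arg_cong[of _ _ card]) auto

lemma prelim_perm_cong:
  assumes "\<And>k. k < N div 2 \<Longrightarrow> w k = w' k"
  shows "prelim_perm n N srt w = prelim_perm n N srt w'"
proof -
  have "wins1 N w = wins1 N w'" unfolding wins1_def using assms by (intro wins_cong) auto
  then show ?thesis unfolding prelim_perm_def by simp
qed

lemma lam_hat_cong:
  assumes "\<And>k. k < N \<Longrightarrow> w k = w' k"
  shows "lam_hat n N srt w = lam_hat n N srt w'"
proof -
  have "wins2 N w = wins2 N w'" unfolding wins2_def using assms by (intro wins_cong) auto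
  moreover have "prelim_perm n N srt w = prelim_perm n N srt w'"
    using assms by (intro prelim_perm_cong) auto
  ultimately show ?thesis unfolding lam_hat_def prelim_perm_def[symmetric] Let_def by simp
qed

lemma ms_sets_cong:
  assumes "\<And>s. 1 \<le> s \<Longrightarrow> s \<le> t \<Longrightarrow> A s = A' s"
  shows "ms_sets C0 C1 n N T lh A t = ms_sets C0 C1 n N T lh A' t"
  using assms by (induction t) auto

lemma stage_wins_cong:
  assumes "\<And>k. k < N + t * (N div T) \<Longrightarrow> w k = w' k" and "s \<le> t"
  shows "stage_wins N T w s = stage_wins N T w' s"
proof -
  have le: "s * (N div T) \<le> t * (N div T)" using assms(2) by (rule mult_right_mono) simp
  show ?thesis unfolding stage_wins_def
  proof (rule wins_cong)
    fix k assume "k \<in> {N + (s - 1) * (N div T)..<N + s * (N div T)}"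
    then have "k < N + s * (N div T)" by simp
    then have "k < N + t * (N div T)" using le by linarith
    then show "w k = w' k" by (rule assms(1))
  qed
qed

definition stage_sets ::
    "nat \<Rightarrow> nat \<Rightarrow> nat \<Rightarrow> ((nat \<Rightarrow> real) \<Rightarrow> nat \<Rightarrow> nat) \<Rightarrow> (nat \<Rightarrow> nat \<times> nat) \<Rightarrow> nat \<Rightarrow> ms_state" where
  "stage_sets n N T srt w t = ms_sets 500 1 n N T (lam_hat n N srt w) (stage_wins N T w) t"

lemma stage_sets_cong:
  assumes "\<And>k. k < N + t * (N div T) \<Longrightarrow> w k = w' k"
  shows "stage_sets n N T srt w t = stage_sets n N T srt w' t"
proof -
  have "lam_hat n N srt w = lam_hat n N srt w'" using assms by (intro lam_hat_cong) auto
  moreover have "stage_wins N T w s = stage_wins N T w' s" if "s \<le> t" for s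
    using stage_wins_cong[OF assms that] .
  ultimately show ?thesis unfolding stage_sets_def by (auto intro: ms_sets_cong)
qed

definition ms_typical ::
    "nat \<Rightarrow> nat \<Rightarrow> nat \<Rightarrow> (nat \<times> nat) pmf \<Rightarrow> ((nat \<Rightarrow> real) \<Rightarrow> nat \<Rightarrow> nat) \<Rightarrow> real \<Rightarrow> (nat \<Rightarrow> nat \<times> nat) \<Rightarrow> bool"
  where "ms_typical n N T D srt x w \<longleftrightarrow>
    (\<forall>i\<in>{1..n}. hits_typical D x {0..<N div 2} ({i} \<times> {1..n}) w) \<and>
    hits_typical D x {N div 2..<N} (far_pairs n (prelim_perm n N srt w)) w \<and>
    (\<forall>t<T. \<forall>i\<in>{1..n}. hits_typical D x {N + t * (N div T)..<N + Suc t * (N div T)}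
      ({i} \<times> fst (stage_sets n N T srt w t i)) w)"

lemma prob_not_hits_typical:
  assumes "finite I" "B \<subseteq> I" "0 < x"
    and "\<And>w w'. (\<And>k. k \<in> I - B \<Longrightarrow> w k = w' k) \<Longrightarrow> G w = G w'"
  shows "measure_pmf.prob (Pi_pmf I d (\<lambda>_. D)) {w. \<not> hits_typical D x B (G w) w} \<le> 2 * exp (- x)"
  using hits_deviation_adapted[OF assms] unfolding hits_typical_def not_le .

lemma prob_not_ms_typical:
  assumes x: "0 < x" and T: "T dvd N"
  shows "measure_pmf.prob (Pi_pmf {..<2 * N} d (\<lambda>_. D)) {w. \<not> ms_typical n N T D srt x w}
    \<le> 2 * (real n + 1 + real T * real n) * exp (- x)"
proof -
  let ?P = "Pi_pmf {..<2 * N} d (\<lambda>_. D)"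
  define E1 where "E1 i = {w. \<not> hits_typical D x {0..<N div 2} ({i} \<times> {1..n}) w}" for i
  define E2 where "E2 = {w. \<not> hits_typical D x {N div 2..<N} (far_pairs n (prelim_perm n N srt w)) w}"
  define E3 where "E3 = (\<lambda>(t, i). {w. \<not> hits_typical D x {N + t * (N div T)..<N + Suc t * (N div T)}
      ({i} \<times> fst (stage_sets n N T srt w t i)) w})"
  have e1: "measure_pmf.prob ?P (E1 i) \<le> 2 * exp (- x)" for i
    unfolding E1_def by (rule prob_not_hits_typical[OF _ _ x]) auto
  have e2: "measure_pmf.prob ?P E2 \<le> 2 * exp (- x)"
    unfolding E2_def by (rule prob_not_hits_typical[OF _ _ x]) (auto intro!: arg_cong[of _ _ "far_pairs n"] prelim_perm_cong)
  have e3: "measure_pmf.prob ?P (E3 p) \<le> 2 * exp (- x)" if "p \<in> {..<T} \<times> {1..n}" for p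
  proof -
    obtain t i where p: "p = (t, i)" and t: "t < T" using \<open>p \<in> _\<close> by auto
    have "Suc t * (N div T) \<le> T * (N div T)" using t by (intro mult_right_mono) auto
    then have "Suc t * (N div T) \<le> N" using T by simp
    then show ?thesis unfolding E3_def p prod.case
      by (intro prob_not_hits_typical[OF _ _ x]) (auto intro!: arg_cong[of _ _ "\<lambda>P. {i} \<times> fst (P i)"] stage_sets_cong)
  qed
  have "{w. \<not> ms_typical n N T D srt x w} \<subseteq> (\<Union>i\<in>{1..n}. E1 i) \<union> (E2 \<union> (\<Union>p\<in>{..<T} \<times> {1..n}. E3 p))"
    unfolding ms_typical_def E1_def E2_def E3_def by fastforce
  then have "measure_pmf.prob ?P {w. \<not> ms_typical n N T D srt x w} \<le>
      measure_pmf.prob ?P ((\<Union>i\<in>{1..n}. E1 i) \<union> (E2 \<union> (\<Union>p\<in>{..<T} \<times> {1..n}. E3 p)))"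
    by (intro measure_pmf.finite_measure_mono) auto
  also have "\<dots> \<le> measure_pmf.prob ?P (\<Union>i\<in>{1..n}. E1 i) +
      (measure_pmf.prob ?P E2 + measure_pmf.prob ?P (\<Union>p\<in>{..<T} \<times> {1..n}. E3 p))"
    by (intro order.trans[OF measure_Un_le] add_left_mono measure_Un_le) auto
  also have "measure_pmf.prob ?P (\<Union>i\<in>{1..n}. E1 i) \<le> (\<Sum>i\<in>{1..n}. measure_pmf.prob ?P (E1 i))"
    by (intro measure_UNION_le) auto
  also have "\<dots> \<le> (\<Sum>i\<in>{1..n}. 2 * exp (- x))" by (intro sum_mono e1)
  also have "measure_pmf.prob ?P (\<Union>p\<in>{..<T} \<times> {1..n}. E3 p) \<le> (\<Sum>p\<in>{..<T} \<times> {1..n}. measure_pmf.prob ?P (E3 p))"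
    by (intro measure_UNION_le) auto
  also have "\<dots> \<le> (\<Sum>p\<in>{..<T} \<times> {1..n}. 2 * exp (- x))" by (intro sum_mono e3)
  finally show ?thesis using e2 by (simp add: algebra_simps)
qed

lemma stage_count_bounds:
  assumes n: "16 \<le> n" and T: "T = nat \<lfloor>log 2 (log 2 (real n))\<rfloor>"
  shows "4 \<le> log 2 (real n)" "2 \<le> T" "real T \<le> log 2 (log 2 (real n))" "T \<le> n"
    "log 2 (real n) / 4 \<le> 2 ^ (T - 1)" "log 2 (real n * real T) \<le> 2 * log 2 (real n)"
    "log 2 (real n) \<le> log 2 (real n * real T)"
proof -
  define l where "l = log 2 (real n)"
  have "log 2 (2 powr 4) \<le> l" unfolding l_def using n by (subst log_le_cancel_iff) auto
  moreover have "log 2 (2 powr 4) = (4 :: real)" by (rule log_powr_cancel) auto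
  ultimately show l4: "4 \<le> log 2 (real n)" unfolding l_def by linarith
  have "log 2 (2 powr 2) \<le> log 2 l" using l4 unfolding l_def by (subst log_le_cancel_iff) auto
  moreover have "log 2 (2 powr 2) = (2 :: real)" by (rule log_powr_cancel) auto
  ultimately have ll: "2 \<le> log 2 l" by linarith
  then show T2: "2 \<le> T" unfolding T l_def[symmetric] by linarith
  show Tl: "real T \<le> log 2 (log 2 (real n))" using ll unfolding T l_def by linarith
  have lT: "log 2 l < real T + 1" using ll unfolding T l_def by linarith
  have l0: "0 < l" using l4 unfolding l_def by simp
  have "l \<le> log 2 (2 powr real n)"
    unfolding l_def using n less_exp[of n] by (subst log_le_cancel_iff) (auto simp: powr_realpow of_nat_less_numeral_power_cancel_iff intro: less_imp_le)
  then have ln: "l \<le> real n" by simp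
  have "2 powr real T \<le> 2 powr log 2 l" using Tl unfolding l_def by (intro powr_mono) auto
  then have "2 ^ T \<le> l" using l0 by (simp add: powr_realpow)
  moreover have "real T < 2 ^ T" using less_exp[of T] by (metis of_nat_less_iff of_nat_numeral of_nat_power)
  ultimately show Tn: "T \<le> n" using ln by linarith
  have "2 powr log 2 l \<le> 2 powr real (Suc T)" using lT by (intro powr_mono) auto
  then have "l \<le> 2 ^ Suc T" using l0 by (simp add: powr_realpow[of 2 "Suc T"] del: of_nat_Suc power_Suc)
  moreover have "(2::real) ^ Suc T = 4 * 2 ^ (T - 1)" using T2 by (cases T) auto
  ultimately show "log 2 (real n) / 4 \<le> 2 ^ (T - 1)" unfolding l_def by simp
  have eq: "log 2 (real n * real T) = l + log 2 (real T)"
    unfolding l_def using n T2 by (subst log_mult) auto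
  have "log 2 (real T) \<le> l" unfolding l_def using n T2 Tn by (subst log_le_cancel_iff) auto
  then show "log 2 (real n * real T) \<le> 2 * log 2 (real n)" using eq unfolding l_def by simp
  have "0 \<le> log 2 (real T)" using T2 by simp
  then show "log 2 (real n) \<le> log 2 (real n * real T)" using eq unfolding l_def by simp
qed

lemma ms_typical_dists:
  fixes c :: real
  assumes c: "0 < c" "c < 1/2" and n: "16 \<le> n" and lam: "c \<le> lam" "lam < 1/2"
    and \<pi>: "\<pi> permutes {1..n}"
  defines "B \<equiv> 5000 / c"
  \<comment> \<open>\<open>1458 * B ^ 8 = 2 * B\<^sup>2 * (9 * B\<^sup>2) ^ 3\<close> gives \<open>B\<^sup>2 * \<beta> * n < 1\<close> whenever \<open>n < 9 * B\<^sup>2\<close>.\<close>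
  assumes N: "1458 * B ^ 8 * real n * log 2 (real n) \<le> real N"
    and T: "T = nat \<lfloor>log 2 (log 2 (real n))\<rfloor>" and even: "even N" and dvd: "T dvd N"
    and srt1: "sorting_rule n srt1" and srt2: "sorting_rule n srt2"
    and typical: "ms_typical n N T (comparison_pmf n lam \<pi>) srt1 (10 * ln (real n)) w"
  shows "linf_dist n (ms_perm 500 1 n N T srt1 srt2 w) \<pi> \<le> B\<^sup>2 * ms_beta n N T"
    and "kt_dist n (ms_perm 500 1 n N T srt1 srt2 w) \<pi> \<le> real n * (B\<^sup>2 * ms_beta n N T)"
proof -
  note t = stage_count_bounds[OF n T]
  define l where "l = log 2 (real n)"
  define \<Lambda> where "\<Lambda> = log 2 (real n * real T)"
  define x where "x = 10 * ln (real n)"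
  define \<beta> where "\<beta> = ms_beta n N T"
  define lh where "lh = lam_hat n N srt1 w"
  have l4: "4 \<le> l" using t unfolding l_def by simp
  have \<Lambda>: "l \<le> \<Lambda>" "\<Lambda> \<le> 2 * l" using t unfolding l_def \<Lambda>_def by auto
  have x0: "0 < x" unfolding x_def using n by simp
  have xl: "x \<le> 10 * l"
  proof -
    have "ln (real n) * ln 2 \<le> ln (real n) * 1"
      using n ln_2_less_1 by (intro mult_left_mono) auto
    then show ?thesis unfolding x_def l_def log_def by (simp add: pos_le_divide_eq)
  qed
  have B1: "10000 \<le> B" using c unfolding B_def by (simp add: field_simps)
  have B0: "0 < B" using B1 by simp
  have N0: "0 < real N"
  proof -
    have "0 < 1458 * B ^ 8 * real n * l" using B0 n l4 by simp
    then show ?thesis using N unfolding l_def by linarith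
  qed
  have cN: "25000000 * real n * l \<le> c\<^sup>2 * real N"
  proof -
    have "B\<^sup>2 * 1 \<le> 1458 * B ^ 8"
    proof -
      have "B ^ 2 \<le> B ^ 8" using B1 by (intro power_increasing) auto
      moreover have "0 \<le> B ^ 8" using B0 by simp
      ultimately show ?thesis by linarith
    qed
    then have "B\<^sup>2 * (real n * l) \<le> 1458 * B ^ 8 * (real n * l)"
      using n l4 by (intro mult_right_mono) auto
    also have "\<dots> \<le> real N" using N unfolding l_def by (simp add: mult.assoc)
    finally have "c\<^sup>2 * (B\<^sup>2 * (real n * l)) \<le> c\<^sup>2 * real N" by (intro mult_left_mono) auto
    moreover have "c\<^sup>2 * (B\<^sup>2 * (real n * l)) = 25000000 * real n * l"
      unfolding B_def using c by (simp add: power_divide)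
    ultimately show ?thesis by simp
  qed
  have nl: "l \<le> real n * l" "0 \<le> real n * l" using n l4 by (auto simp: mult_le_cancel_right1)
  have nx: "real n * x \<le> 10 * (real n * l)" using xl n mult_left_mono[of x "10 * l" "real n"] by simp
  have c2: "c\<^sup>2 * real N \<le> 1 * real N"
    using c power_le_one[of c 2] by (intro mult_right_mono) auto
  have lam': "0 \<le> lam" "lam \<le> 1/2" using lam c by auto
  have n2: "2 \<le> n" using n by simp
  have hit1: "\<And>i. i \<in> {1..n} \<Longrightarrow> hits_typical (comparison_pmf n lam \<pi>) x {0..<N div 2} ({i} \<times> {1..n}) w"
    and hit2: "hits_typical (comparison_pmf n lam \<pi>) x {N div 2..<N} (far_pairs n (prelim_perm n N srt1 w)) w"
    and hit3: "\<And>t i. t < T \<Longrightarrow> i \<in> {1..n} \<Longrightarrow> hits_typical (comparison_pmf n lam \<pi>) x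
      {N + t * (N div T)..<N + Suc t * (N div T)} ({i} \<times> fst (stage_sets n N T srt1 w t i)) w"
    using typical unfolding ms_typical_def x_def by blast+
  have "64 * real n * x \<le> c\<^sup>2 * real N" "real n * x \<le> real N"
    using cN nx nl c2 by linarith+
  note close = prelim_perm_close[OF \<pi> lam(1) lam'(2) c(1) n2 even this x0 srt1 hit1]
  have "2 * x \<le> real N" using cN xl nl c2 by linarith
  note lh = lam_hat_error[OF \<pi> lam' n even this x0 srt1 close hit2, folded lh_def]
  have \<beta>_eq: "\<beta> = (real n)\<^sup>2 * (real T * \<Lambda> / real N)"
    unfolding \<beta>_def ms_beta_def \<Lambda>_def by simp
  have \<beta>0: "0 < \<beta>" unfolding \<beta>_eq using n N0 t(2) \<Lambda> l4 by simp
  have e1: "13 * sqrt (x / real N) \<le> c / 2"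
  proof (rule power2_le_imp_le)
    have "(13 * sqrt (x / real N))\<^sup>2 = 169 * x / real N"
      using x0 by (simp add: power_mult_distrib)
    also have "\<dots> \<le> c\<^sup>2 / 4"
    proof -
      have "676 * x \<le> c\<^sup>2 * real N" using cN xl nl by linarith
      then show ?thesis using N0 by (simp add: pos_divide_le_eq)
    qed
    finally show "(13 * sqrt (x / real N))\<^sup>2 \<le> (c / 2)\<^sup>2" by (simp add: power_divide)
  qed (use c in simp)
  have e2: "13 * sqrt (x / real N) \<le> 50 * sqrt \<beta> / real n"
  proof (rule power2_le_imp_le)
    have "(13 * sqrt (x / real N))\<^sup>2 = 169 * x / real N"
      using x0 by (simp add: power_mult_distrib)
    also have "\<dots> \<le> 2500 * (real T * \<Lambda>) / real N"
    proof (rule divide_right_mono)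
      have "1 * \<Lambda> \<le> real T * \<Lambda>" using t(2) \<Lambda> l4 by (intro mult_right_mono) auto
      then have "\<Lambda> \<le> real T * \<Lambda>" by simp
      then show "169 * x \<le> 2500 * (real T * \<Lambda>)" using xl \<Lambda> l4 by linarith
    qed simp
    also have "\<dots> = (50 * sqrt \<beta> / real n)\<^sup>2"
      using \<beta>0 n by (simp add: power_mult_distrib power_divide) (simp add: \<beta>_eq)
    finally show "(13 * sqrt (x / real N))\<^sup>2 \<le> (50 * sqrt \<beta> / real n)\<^sup>2" .
  qed (use \<beta>0 in simp)
  have "0 \<le> 3 / real n" by simp
  then have lh_dist: "\<bar>lh - lam\<bar> \<le> 3 / real n + 50 * sqrt \<beta> / real n"
    using lh e2 by linarith
  have lh_c: "c / 2 \<le> lh" using lh(1) e1 lam by linarith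
  have small: "9 * B\<^sup>2 \<le> real n \<or> B\<^sup>2 * \<beta> * real n < 1"
  proof (rule disjCI)
    assume "\<not> B\<^sup>2 * \<beta> * real n < 1"
    then have "1 \<le> B\<^sup>2 * \<beta> * real n" by simp
    then have "real N * 1 \<le> real N * (B\<^sup>2 * \<beta> * real n)" using N0 by (intro mult_left_mono) auto
    also have "\<dots> = B\<^sup>2 * real n ^ 3 * (real T * \<Lambda>)"
      unfolding \<beta>_eq using N0 by (simp add: power2_eq_square power3_eq_cube)
    also have "\<dots> \<le> B\<^sup>2 * real n ^ 3 * (real n * (2 * l))"
      using t(4) \<Lambda> l4 by (intro mult_left_mono mult_mono) auto
    finally have "1458 * B ^ 8 * real n * l \<le> B\<^sup>2 * real n ^ 3 * (real n * (2 * l))"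
      using N unfolding l_def by linarith
    moreover have "1458 * B ^ 8 * real n * l = (2 * B\<^sup>2 * real n * l) * (9 * B\<^sup>2) ^ 3"
      by (simp add: power_mult_distrib power_mult[symmetric] power_add[symmetric] algebra_simps)
    moreover have "B\<^sup>2 * real n ^ 3 * (real n * (2 * l)) = (2 * B\<^sup>2 * real n * l) * real n ^ 3"
      by simp
    ultimately have "(9 * B\<^sup>2) ^ 3 \<le> real n ^ 3" using B0 n l4 by simp
    then show "9 * B\<^sup>2 \<le> real n" by (subst (asm) power_mono_iff) auto
  qed
  have noise: "ms_noise_ok n N T lam \<pi> (stage_wins N T w (Suc s)) (stage_sets n N T srt1 w s)" if "s < T" for s
  proof (rule ms_noise_okI[OF \<pi> lam' n2 _ dvd])
    show "x \<le> 10 * log 2 (real n * real T)" using xl \<Lambda> unfolding \<Lambda>_def by simp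
  qed (use N0 x0 hit3[OF that] in \<open>auto simp: stage_sets_def dest: set_mp[OF ms_sets_subset]\<close>)
  note dists = ms_final_dists[OF \<pi> c lam(1) lh_c \<beta>0[unfolded \<beta>_def] small[unfolded \<beta>_def B_def]
      noise[unfolded stage_sets_def, folded lh_def] lh_dist[unfolded \<beta>_def] t(2) t(5) n2 srt2, folded B_def]
  then show "linf_dist n (ms_perm 500 1 n N T srt1 srt2 w) \<pi> \<le> B\<^sup>2 * ms_beta n N T"
    and "kt_dist n (ms_perm 500 1 n N T srt1 srt2 w) \<pi> \<le> real n * (B\<^sup>2 * ms_beta n N T)"
    unfolding ms_perm_def Let_def lh_def by simp_all
qed

theorem theorem2:
  fixes c :: real
  assumes "0 < c" "c < 1/2"
  shows "\<exists>C C0 C1 K :: real. C > 0 \<and> C0 > 0 \<and> C1 > 0 \<and> K > 0 \<and>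
    (\<forall>(n :: nat) (lam :: real) (\<pi> :: nat \<Rightarrow> nat) (N :: nat) (T :: nat) srt1 srt2.
       n \<ge> 16 \<longrightarrow> c \<le> lam \<longrightarrow> lam < 1/2 \<longrightarrow> \<pi> permutes {1..n} \<longrightarrow>
       real N \<ge> C * real n * log 2 (real n) \<longrightarrow>
       T = nat \<lfloor>log 2 (log 2 (real n))\<rfloor> \<longrightarrow>
       even N \<longrightarrow> T dvd N \<longrightarrow>
       sorting_rule n srt1 \<longrightarrow> sorting_rule n srt2 \<longrightarrow>
       measure_pmf.prob (comparisons_pmf n lam \<pi> (2 * N))
         {\<omega>. linf_dist n (ms_perm C0 C1 n N T srt1 srt2 \<omega>) \<pi>
                \<le> K * ((real n)^2 / real N) * log 2 (real n) * log 2 (log 2 (real n)) \<and>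
              kt_dist n (ms_perm C0 C1 n N T srt1 srt2 \<omega>) \<pi>
                \<le> K * ((real n)^3 / real N) * log 2 (real n) * log 2 (log 2 (real n))}
         \<ge> 1 - 1 / (real n)^7)"
proof -
  define B where "B = 5000 / c"
  have B0: "0 < B" unfolding B_def using assms by simp
  have main: "1 - 1 / (real n)^7 \<le> measure_pmf.prob (comparisons_pmf n lam \<pi> (2 * N))
         {\<omega>. linf_dist n (ms_perm 500 1 n N T srt1 srt2 \<omega>) \<pi>
                \<le> 2 * B\<^sup>2 * ((real n)^2 / real N) * log 2 (real n) * log 2 (log 2 (real n)) \<and>
              kt_dist n (ms_perm 500 1 n N T srt1 srt2 \<omega>) \<pi>
                \<le> 2 * B\<^sup>2 * ((real n)^3 / real N) * log 2 (real n) * log 2 (log 2 (real n))}"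
    (is "_ \<le> measure_pmf.prob ?P ?E")
    if n: "16 \<le> n" and lam: "c \<le> lam" "lam < 1/2" and \<pi>: "\<pi> permutes {1..n}"
      and N: "1458 * B ^ 8 * real n * log 2 (real n) \<le> real N"
      and T: "T = nat \<lfloor>log 2 (log 2 (real n))\<rfloor>" and even: "even N" and dvd: "T dvd N"
      and srt: "sorting_rule n srt1" "sorting_rule n srt2"
    for n lam \<pi> N T srt1 srt2
  proof -
    define x where "x = 10 * ln (real n)"
    define D where "D = comparison_pmf n lam \<pi>"
    note t = stage_count_bounds[OF n T]
    define K where "K = 2 * B\<^sup>2 * ((real n)^2 / real N) * log 2 (real n) * log 2 (log 2 (real n))"
    have "ms_beta n N T = (real n)^2 / real N * (log 2 (real n * real T) * real T)"
      unfolding ms_beta_def by simp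
    also have "\<dots> \<le> (real n)^2 / real N * (2 * log 2 (real n) * log 2 (log 2 (real n)))"
      using t by (intro mult_left_mono mult_mono) auto
    finally have "B\<^sup>2 * ms_beta n N T \<le> B\<^sup>2 * ((real n)^2 / real N * (2 * log 2 (real n) * log 2 (log 2 (real n))))"
      by (intro mult_left_mono) auto
    then have K: "B\<^sup>2 * ms_beta n N T \<le> K" unfolding K_def by (simp add: mult_ac)
    then have nK: "real n * (B\<^sup>2 * ms_beta n N T) \<le> real n * K" by (intro mult_left_mono) auto
    have K3: "real n * K = 2 * B\<^sup>2 * ((real n)^3 / real N) * log 2 (real n) * log 2 (log 2 (real n))"
      unfolding K_def by (simp add: power2_eq_square power3_eq_cube)
    have E: "- {w. \<not> ms_typical n N T D srt1 x w} \<subseteq> ?E"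
      using ms_typical_dists[OF assms n lam \<pi> _ T even dvd srt, folded B_def, OF N] K nK
      unfolding K_def[symmetric] K3[symmetric] x_def D_def by (auto intro: order.trans)
    have x0: "0 < x" unfolding x_def using n by simp
    have "exp (- x) = 1 / real n ^ 10"
    proof -
      have "exp x = exp (ln (real n)) ^ 10" unfolding x_def by (simp add: exp_of_nat_mult[symmetric])
      then show ?thesis using n by (simp add: exp_minus field_simps)
    qed
    moreover have "2 * (real n + 1 + real T * real n) \<le> real n ^ 3"
    proof -
      have "T * n \<le> n * n" using t(4) by (rule mult_right_mono) simp
      moreover have "16 * n \<le> n * n" "16 * (n * n) \<le> n * (n * n)" using n by (auto intro: mult_right_mono)
      ultimately have "2 * n + 2 + 2 * (T * n) \<le> n * (n * n)" using n by linarith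
      then have "2 * (n + 1 + T * n) \<le> n ^ 3" by (simp add: power3_eq_cube algebra_simps)
      then have "real (2 * (n + 1 + T * n)) \<le> real (n ^ 3)" by (rule of_nat_mono)
      then show ?thesis by simp
    qed
    ultimately have "2 * (real n + 1 + real T * real n) * exp (- x) \<le> real n ^ 3 * (1 / real n ^ 10)"
      by (simp add: divide_right_mono)
    also have "\<dots> = 1 / real n ^ 7" using n by (simp add: field_simps power_add[symmetric])
    finally have "measure_pmf.prob ?P {w. \<not> ms_typical n N T D srt1 x w} \<le> 1 / real n ^ 7"
      using prob_not_ms_typical[OF x0 dvd, of undefined D n srt1]
      unfolding comparisons_pmf_def D_def by linarith
    moreover have "measure_pmf.prob ?P (- {w. \<not> ms_typical n N T D srt1 x w}) =
        1 - measure_pmf.prob ?P {w. \<not> ms_typical n N T D srt1 x w}"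
      using measure_pmf.prob_compl[of "{w. \<not> ms_typical n N T D srt1 x w}" ?P] by (simp add: Compl_eq_Diff_UNIV)
    moreover have "measure_pmf.prob ?P (- {w. \<not> ms_typical n N T D srt1 x w}) \<le> measure_pmf.prob ?P ?E"
      using E by (intro measure_pmf.finite_measure_mono) auto
    ultimately show ?thesis by linarith
  qed
  show ?thesis
  proof (rule exI[of _ "1458 * B ^ 8"], rule exI[of _ 500], rule exI[of _ 1], rule exI[of _ "2 * B\<^sup>2"],
      intro conjI allI impI)
    show "0 < 1458 * B ^ 8" "0 < (500 :: real)" "0 < (1 :: real)" "0 < 2 * B\<^sup>2" using B0 by simp_all
  qed (rule main)
qed

end
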